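(* For every dimension $n$ and every $\alpha>0$ there exist positive constants $c_0=c_0(n)$, $r_0=r_0(n,\alpha)$ and $\beta_0=\beta_0(n,\alpha)$ with $\beta_0 r_0^2=c_0$ such that the following holds. Let $\Omega\subset\mathbb{R}^n$ be a bounded $\alpha$-asymmetric domain, let $D\subset\mathbb{R}^n$ be a bounded domain, and let $x\in\mathbb{R}^n$ be such that $\rho_x>0$. Then $$\lambda_1(\Omega\setminus(x+D))\le \beta(\rho_x)\,\lambda_1(\Omega),$$ where $\beta:(0,\infty)\to(0,\infty)$ is the continuous, decreasing (in the non-strict sense) function $$\beta(\rho)=\begin{cases}\beta_0, & \rho\sqrt{\lambda_1(\Omega)}>r_0,\\[4pt] \dfrac{c_0}{\rho^2\lambda_1(\Omega)}, & \rho\sqrt{\lambda_1(\Omega)}\le r_0.\end{cases}$$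
   Context: A domain is a nonempty connected open set. For $\alpha>0$, a bounded domain $\Omega\subset\mathbb{R}^n$ is called $\alpha$-asymmetric if for all $y\in\partial\Omega$ and all $r>0$, $\frac{|B_r(y)\setminus\Omega|}{|B_r(y)|}\ge\alpha$, where $B_r(y)$ is the ball of radius $r$ centered at $y$ and $|\cdot|$ is Lebesgue measure. $\lambda_1(U)$ denotes the first eigenvalue of $-\Delta$ on $U$ with Dirichlet boundary conditions; for the set $U=\Omega\setminus(x+D)$ this is understood as the infimum of $\int|\nabla u|^2/\int u^2$ over nonzero $u\in C_c^\infty(\operatorname{int}U)$ ($+\infty$ if the interior is empty). $\phi_{\lambda_1(\Omega)}>0$ denotes the first Dirichlet eigenfunction (ground state) of $\Omega$, and $$M:=\{y\in\Omega:\ \phi_{\lambda_1(\Omega)}(y)=\|\phi_{\lambda_1(\Omega)}\|_{L^\infty(\Omega)}\}$$ is its set of maximum points. The bounded domain $D$ is the "obstacle", $x+D$ is its translate by $x\in\mathbb{R}^n$, and $$\rho_x:=\max_{y\in M} d(y,x+D),$$ where $d(y,x+D)$ is the Euclidean distance from the point $y$ to the set $x+D$. *)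

theory Defs
  imports "HOL-Analysis.Analysis" "HOL-Probability.Essential_Supremum"
begin

definition domain_set :: "'a::euclidean_space set \<Rightarrow> bool" where
  "domain_set U \<longleftrightarrow> U \<noteq> {} \<and> open U \<and> connected U"

definition asymmetric_domain :: "real \<Rightarrow> 'a::euclidean_space set \<Rightarrow> bool" where
  "asymmetric_domain \<alpha> \<Omega> \<longleftrightarrow> domain_set \<Omega> \<and> bounded \<Omega> \<and>
     (\<forall>y\<in>frontier \<Omega>. \<forall>r>0.
        measure lebesgue (ball y r - \<Omega>) / measure lebesgue (ball y r) \<ge> \<alpha>)"

primrec iterated_partial ::
    "'a::euclidean_space list \<Rightarrow> ('a \<Rightarrow> real) \<Rightarrow> 'a \<Rightarrow> real" where
  "iterated_partial [] u = u"
| "iterated_partial (b # bs) u = (\<lambda>x. frechet_derivative (iterated_partial bs u) (at x) b)"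

text \<open>Infinite differentiability on the whole space: every iterated partial derivative is
  again (totally) differentiable everywhere.\<close>

definition smooth_fun :: "('a::euclidean_space \<Rightarrow> real) \<Rightarrow> bool" where
  "smooth_fun u \<longleftrightarrow>
     (\<forall>bs. set bs \<subseteq> Basis \<longrightarrow> (\<forall>x. iterated_partial bs u differentiable (at x)))"

text \<open>Test functions are functions on the whole space, vanishing outside a compact
  subset of \<open>U\<close>.\<close>

definition test_functions :: "'a::euclidean_space set \<Rightarrow> ('a \<Rightarrow> real) set" where
  "test_functions U =
     {u. smooth_fun u \<and> compact (closure {x. u x \<noteq> 0}) \<and> closure {x. u x \<noteq> 0} \<subseteq> U}"

definition gradient :: "('a::euclidean_space \<Rightarrow> real) \<Rightarrow> 'a \<Rightarrow> 'a" where
  "gradient u x = (\<Sum>b\<in>Basis. frechet_derivative u (at x) b *\<^sub>R b)"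

text \<open>The variational first eigenvalue of a set that need not be open; the infimum is
  \<open>\<infinity>\<close> if there is no nonzero test function, that is, if the interior is empty.\<close>

definition rayleigh_lambda1 :: "'a::euclidean_space set \<Rightarrow> ereal" where
  "rayleigh_lambda1 U =
     (INF u \<in> test_functions (interior U) - {\<lambda>x. 0}.
        ereal ((LINT x|lebesgue. (norm (gradient u x))\<^sup>2) / (LINT x|lebesgue. (u x)\<^sup>2)))"

text \<open>\<open>H10 U u g\<close>: the restriction of \<open>u\<close> to \<open>U\<close> lies in \<open>H\<^sub>0\<^sup>1(U)\<close>, the closure of the test
  functions in the Sobolev norm, and has weak gradient \<open>g\<close>. Values outside \<open>U\<close> play no role.
  The integrals are \<open>ennreal\<close>-valued, so that convergence to \<open>0\<close> entails square
  integrability of \<open>u\<close> and \<open>g\<close>.\<close>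

definition H10 ::
    "'a::euclidean_space set \<Rightarrow> ('a \<Rightarrow> real) \<Rightarrow> ('a \<Rightarrow> 'a) \<Rightarrow> bool" where
  "H10 U u g \<longleftrightarrow>
     u \<in> borel_measurable (lebesgue_on U) \<and> g \<in> borel_measurable (lebesgue_on U) \<and>
     (\<exists>w :: nat \<Rightarrow> 'a \<Rightarrow> real. (\<forall>k. w k \<in> test_functions U) \<and>
        (\<lambda>k. \<integral>\<^sup>+x. ennreal ((w k x - u x)\<^sup>2) \<partial>lebesgue_on U) \<longlonglongrightarrow> 0 \<and>
        (\<lambda>k. \<integral>\<^sup>+x. ennreal ((norm (gradient (w k) x - g x))\<^sup>2) \<partial>lebesgue_on U) \<longlonglongrightarrow> 0)"

text \<open>Nonzero weak solutions \<open>u \<in> H\<^sub>0\<^sup>1(U)\<close> of \<open>-\<Delta>u = \<mu>u\<close> in the open set \<open>U\<close>.\<close>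

definition dirichlet_eigenfunction ::
    "'a::euclidean_space set \<Rightarrow> real \<Rightarrow> ('a \<Rightarrow> real) \<Rightarrow> bool" where
  "dirichlet_eigenfunction U \<mu> u \<longleftrightarrow>
     \<not> (AE x in lebesgue_on U. u x = 0) \<and>
     (\<exists>g. H10 U u g \<and>
        (\<forall>v\<in>test_functions U.
           (LINT x|lebesgue_on U. g x \<bullet> gradient v x) = \<mu> * (LINT x|lebesgue_on U. u x * v x)))"

definition first_dirichlet_eigenvalue :: "'a::euclidean_space set \<Rightarrow> real" where
  "first_dirichlet_eigenvalue U = Inf {\<mu>. \<exists>u. dirichlet_eigenfunction U \<mu> u}"

text \<open>The positive first eigenfunction, in its continuous version (so that pointwise values
  make sense); it is unique up to a positive factor.\<close>

definition ground_state :: "'a::euclidean_space set \<Rightarrow> ('a \<Rightarrow> real) \<Rightarrow> bool" where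
  "ground_state \<Omega> \<phi> \<longleftrightarrow>
     dirichlet_eigenfunction \<Omega> (first_dirichlet_eigenvalue \<Omega>) \<phi> \<and>
     continuous_on \<Omega> \<phi> \<and> (\<forall>x\<in>\<Omega>. \<phi> x > 0)"

definition max_points :: "'a::euclidean_space set \<Rightarrow> ('a \<Rightarrow> real) \<Rightarrow> 'a set" where
  "max_points \<Omega> \<phi> = {y\<in>\<Omega>. ereal (\<phi> y) = esssup (lebesgue_on \<Omega>) (\<lambda>x. ereal \<bar>\<phi> x\<bar>)}"

definition translate :: "'a::euclidean_space \<Rightarrow> 'a set \<Rightarrow> 'a set" where
  "translate x D = (\<lambda>z. x + z) ` D"

text \<open>For \<open>\<alpha>\<close>-asymmetric domains the set of maximum points is nonempty and compact, so
  this supremum is a maximum.\<close>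

definition max_dist ::
    "'a::euclidean_space set \<Rightarrow> ('a \<Rightarrow> real) \<Rightarrow> 'a set \<Rightarrow> 'a \<Rightarrow> real" where
  "max_dist \<Omega> \<phi> D x = (SUP y\<in>max_points \<Omega> \<phi>. infdist y (translate x D))"

definition beta_fun :: "real \<Rightarrow> real \<Rightarrow> real \<Rightarrow> real \<Rightarrow> real \<Rightarrow> real" where
  "beta_fun c\<^sub>0 r\<^sub>0 \<beta>\<^sub>0 l \<rho> =
     (if \<rho> * sqrt l > r\<^sub>0 then \<beta>\<^sub>0 else c\<^sub>0 / (\<rho>\<^sup>2 * l))"

end

theory Submission
  imports Defs "HOL-Probability.Distributions"
begin

text \<open>Extended by zero, the ground state $u$ satisfies $-\Delta u \le \lambda_1 u$ on the whole space: test the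
  equation with $\psi \tanh(m u)$ and let $m \to \infty$. Testing with Gaussians shows that
  $e^{\lambda_1 t}$ times the heat evolution of $u$ is nondecreasing in $t$, so $u$ lies below it.
  This bounds $u$, and at time $t = d^2$, where $d$ is the distance from $y$ to the boundary, the
  asymmetry makes a fixed portion of the Gaussian around $y$ fall outside $\Omega$; hence
  $u(y) \le e^{\lambda_1 d^2} (1 - \kappa) \sup u$ with $\kappa > 0$ depending only on $n$ and $\alpha$. So the maximum is attained, and only at points with
  $\lambda_1 d^2 \ge \kappa$. A ball of radius comparable to $\min(\rho, \lambda_1^{-1/2})$
  around such a point avoids the obstacle and carries a scaled bump as a competitor.\<close>

subsection \<open>Smooth functions\<close>

text \<open>The competitor needs a ball inside the domain that misses the obstacle, so the crux is a
  lower bound for the distance from a maximum point to the boundary. Asymmetry is a measure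
  condition without boundary regularity: it offers no barriers and no pointwise boundary values of
  \<open>u\<close>, but averages over the whole space do see the missing volume. Hence the equation
  is carried across the boundary and tested with Gaussians, which do not vanish there. Membership in
  \<open>H10\<close> only gives L2 approximation by test functions \<open>w k\<close>; a factor
  \<open>tanh (m * w k)\<close> makes an arbitrary smooth function admissible, and differentiating
  it yields a term of favourable sign plus one that vanishes in the limit. At time d^2 the Gaussian,
  the ball of radius d and its missing part all scale alike, so d cancels. The asymmetry \<alpha>
  enters only through \<kappa>, that is, through the threshold \<open>r\<^sub>0\<close>, the square
  root of \<kappa>; \<open>c\<^sub>0\<close> comes from the Rayleigh quotient of one fixed bump and
  hence depends on the dimension alone.\<close>

primrec diffk :: "nat \<Rightarrow> ('a::euclidean_space \<Rightarrow> real) \<Rightarrow> bool" where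
  "diffk 0 u \<longleftrightarrow> True"
| "diffk (Suc k) u \<longleftrightarrow> (\<forall>x. u differentiable (at x)) \<and>
     (\<forall>b\<in>Basis. diffk k (\<lambda>x. frechet_derivative u (at x) b))"

lemma iterated_partial_snoc:
  "iterated_partial (bs @ [b]) u = iterated_partial bs (\<lambda>x. frechet_derivative u (at x) b)"
  by (induction bs) auto

text \<open>\<open>iterated_partial\<close> applies the head of the list last, whereas
  \<open>diffk\<close> takes its first derivative innermost, so lists are taken apart at their end.
  Counting orders gives an induction that suits products and compositions.\<close>

lemma diffk_iff_iterated:
  "diffk k u \<longleftrightarrow> (\<forall>bs. length bs < k \<longrightarrow> set bs \<subseteq> Basis \<longrightarrow>
     (\<forall>x. iterated_partial bs u differentiable (at x)))"
proof (induction k arbitrary: u)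
  case 0
  show ?case by simp
next
  case (Suc k)
  show ?case
  proof (intro iffI allI impI)
    fix bs :: "'a list" and x
    assume u: "diffk (Suc k) u" and bs: "length bs < Suc k" "set bs \<subseteq> Basis"
    show "iterated_partial bs u differentiable (at x)"
    proof (cases bs rule: rev_cases)
      case Nil
      then show ?thesis using u by simp
    next
      case (snoc bs' b)
      then show ?thesis using u bs Suc.IH by (simp add: iterated_partial_snoc)
    qed
  next
    assume u: "\<forall>bs. length bs < Suc k \<longrightarrow> set bs \<subseteq> Basis \<longrightarrow>
      (\<forall>x. iterated_partial bs u differentiable (at x))"
    have "\<forall>x. u differentiable (at x)"
      using u[rule_format, of "[]"] by simp
    moreover have "iterated_partial bs (\<lambda>x. frechet_derivative u (at x) b) differentiable (at x)"
      if "b \<in> Basis" "length bs < k" "set bs \<subseteq> Basis" for b bs x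
      using u[rule_format, of "bs @ [b]" x] that by (simp add: iterated_partial_snoc)
    ultimately show "diffk (Suc k) u"
      using Suc.IH by simp
  qed
qed

lemma smooth_fun_iff_diffk: "smooth_fun u \<longleftrightarrow> (\<forall>k. diffk k u)"
  unfolding smooth_fun_def diffk_iff_iterated by blast

lemma smooth_fun_differentiable: "smooth_fun u \<Longrightarrow> u differentiable (at x)"
  using diffk.simps(2) smooth_fun_iff_diffk by blast

lemma smooth_fun_partial:
  "smooth_fun u \<Longrightarrow> b \<in> Basis \<Longrightarrow> smooth_fun (\<lambda>x. frechet_derivative u (at x) b)"
  using diffk.simps(2) smooth_fun_iff_diffk by blast

lemma smooth_fun_has_derivative:
  "smooth_fun u \<Longrightarrow> (u has_derivative frechet_derivative u (at x)) (at x)"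
  using smooth_fun_differentiable frechet_derivative_works by blast

lemma smooth_fun_continuous_on: "smooth_fun u \<Longrightarrow> continuous_on A u"
  by (meson smooth_fun_differentiable continuous_at_imp_continuous_on differentiable_imp_continuous_within)

lemma frechet_derivative_inner_gradient:
  assumes "smooth_fun u"
  shows "frechet_derivative u (at x) h = gradient u x \<bullet> h"
proof -
  interpret D: bounded_linear "frechet_derivative u (at x)"
    using smooth_fun_has_derivative[OF assms] has_derivative_bounded_linear by blast
  have "frechet_derivative u (at x) h =
      frechet_derivative u (at x) (\<Sum>b\<in>Basis. (h \<bullet> b) *\<^sub>R b)"
    by (simp add: euclidean_representation)
  also have "\<dots> = (\<Sum>b\<in>Basis. (h \<bullet> b) * frechet_derivative u (at x) b)"
    by (simp add: D.sum D.scaleR)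
  also have "\<dots> = gradient u x \<bullet> h"
    unfolding gradient_def inner_sum_left
    by (intro sum.cong refl) (simp add: inner_commute mult.commute)
  finally show ?thesis .
qed

lemma smooth_fun_has_derivative_gradient:
  assumes "smooth_fun u"
  shows "(u has_derivative (\<lambda>h. gradient u x \<bullet> h)) (at x)"
proof -
  have "frechet_derivative u (at x) = (\<lambda>h. gradient u x \<bullet> h)"
    using frechet_derivative_inner_gradient[OF assms] by blast
  then show ?thesis
    using smooth_fun_has_derivative[OF assms, of x] by simp
qed

lemma gradient_unique:
  assumes "(u has_derivative (\<lambda>h. v \<bullet> h)) (at x)"
  shows "gradient u x = v"
proof -
  have "frechet_derivative u (at x) = (\<lambda>h. v \<bullet> h)"
    using frechet_derivative_at[OF assms] by simp
  then show ?thesis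
    by (simp add: gradient_def euclidean_representation)
qed

lemma continuous_on_gradient:
  assumes "smooth_fun u" shows "continuous_on A (gradient u)"
  unfolding gradient_def[abs_def]
  by (intro continuous_intros smooth_fun_continuous_on smooth_fun_partial assms)

lemma diffkI:
  assumes "\<And>x. (u has_derivative u' x) (at x)" "\<And>b. b \<in> Basis \<Longrightarrow> diffk k (\<lambda>x. u' x b)"
  shows "diffk (Suc k) u"
proof -
  have "frechet_derivative u (at x) = u' x" for x
    using frechet_derivative_at[OF assms(1)] by simp
  then show ?thesis
    using assms by (auto simp: differentiable_def)
qed

lemma diffk_has_derivative:
  "diffk (Suc k) u \<Longrightarrow> (u has_derivative frechet_derivative u (at x)) (at x)"
  using frechet_derivative_works by auto

lemma diffk_Suc_imp: "diffk (Suc k) u \<Longrightarrow> diffk k u"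
  by (auto simp: diffk_iff_iterated)

lemma diffk_const: "diffk k (\<lambda>x. c)"
proof (induction k arbitrary: c)
  case (Suc k)
  show ?case by (rule diffkI[where u' = "\<lambda>x h. 0"]) (auto simp: Suc)
qed simp

lemma diffk_inner_left: "diffk k (\<lambda>x. x \<bullet> b)"
proof (cases k)
  case (Suc k')
  show ?thesis unfolding Suc
    by (rule diffkI[where u' = "\<lambda>x h. h \<bullet> b"]) (auto simp: diffk_const intro!: derivative_eq_intros)
qed simp

lemma diffk_add: "diffk k u \<Longrightarrow> diffk k v \<Longrightarrow> diffk k (\<lambda>x. u x + v x)"
proof (induction k arbitrary: u v)
  case (Suc k)
  show ?case
    by (rule diffkI, rule has_derivative_add[OF diffk_has_derivative[OF Suc.prems(1)] diffk_has_derivative[OF Suc.prems(2)]])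
      (use Suc in simp)
qed simp

lemma diffk_mult: "diffk k u \<Longrightarrow> diffk k v \<Longrightarrow> diffk k (\<lambda>x. u x * v x)"
proof (induction k arbitrary: u v)
  case (Suc k)
  show ?case
  proof (rule diffkI, rule has_derivative_mult[OF diffk_has_derivative[OF Suc.prems(1)] diffk_has_derivative[OF Suc.prems(2)]])
    fix b :: 'a assume "b \<in> Basis"
    then have "diffk k (\<lambda>x. frechet_derivative u (at x) b)" "diffk k (\<lambda>x. frechet_derivative v (at x) b)"
      using Suc.prems by simp_all
    then show "diffk k (\<lambda>x. u x * frechet_derivative v (at x) b + frechet_derivative u (at x) b * v x)"
      using Suc.prems[THEN diffk_Suc_imp] by (intro diffk_add Suc.IH)
  qed
qed simp

lemma diffk_sum: "(\<And>i. i \<in> I \<Longrightarrow> diffk k (u i)) \<Longrightarrow> diffk k (\<lambda>x. \<Sum>i\<in>I. u i x)"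
  by (induction I rule: infinite_finite_induct) (auto simp: diffk_const intro!: diffk_add)

text \<open>A whole family is treated at once because the derivative of one member may involve
  others. By the chain rule, order k + 1 of \<open>f i\<close> composed with \<open>u\<close>
  reduces to order k of \<open>f' i\<close> composed with \<open>u\<close>, which
  \<open>step\<close> obtains from order k of all members.\<close>

lemma diffk_compose:
  fixes u :: "'a::euclidean_space \<Rightarrow> real"
  assumes "diffk k u"
    and "\<And>i s. i \<in> I \<Longrightarrow> (f i has_real_derivative f' i s) (at s)"
    and step: "\<And>k (u :: 'a \<Rightarrow> real) i. i \<in> I \<Longrightarrow> (\<And>j. j \<in> I \<Longrightarrow> diffk k (\<lambda>x. f j (u x))) \<Longrightarrow>
       diffk k (\<lambda>x. f' i (u x))"
    and "i \<in> I"
  shows "diffk k (\<lambda>x. f i (u x))"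
  using assms(1,4)
proof (induction k arbitrary: i)
  case (Suc k)
  show ?case
  proof (rule diffkI)
    fix x
    show "((\<lambda>x. f i (u x)) has_derivative
       (\<lambda>h. f' i (u x) * frechet_derivative u (at x) h)) (at x)"
      by (rule has_derivative_compose[OF diffk_has_derivative[OF Suc.prems(1)]
            assms(2)[OF Suc.prems(2), unfolded has_field_derivative_def]])
  next
    fix b :: 'a assume "b \<in> Basis"
    then have "diffk k (\<lambda>x. frechet_derivative u (at x) b)"
      using Suc.prems(1) by simp
    moreover have "diffk k (\<lambda>x. f' i (u x))"
      by (rule step[OF Suc.prems(2)]) (rule Suc.IH[OF diffk_Suc_imp[OF Suc.prems(1)]])
    ultimately show "diffk k (\<lambda>x. f' i (u x) * frechet_derivative u (at x) b)"
      by (intro diffk_mult)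
  qed
qed simp

text \<open>The derivative is a polynomial in tanh itself, so a family with one member suffices; it
  is spelled with sums and products to match the closure rules.\<close>

lemma diffk_tanh:
  assumes "diffk k u" shows "diffk k (\<lambda>x. tanh (u x))"
proof (rule diffk_compose[where f = "\<lambda>_::unit. tanh" and f' = "\<lambda>_ s. 1 + (-1) * (tanh s * tanh s)" and I = UNIV, OF assms])
  show "(tanh has_real_derivative 1 + (-1) * (tanh s * tanh s)) (at s)" for s :: real
    by (auto intro!: derivative_eq_intros simp: power2_eq_square)
  show "diffk k (\<lambda>x. 1 + (-1) * (tanh (u x) * tanh (u x)))"
    if "\<And>j::unit. j \<in> UNIV \<Longrightarrow> diffk k (\<lambda>x. tanh (u x))" for k and u :: "'a \<Rightarrow> real"
    by (intro diffk_add diffk_mult diffk_const that UNIV_I)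
qed auto

lemma diffk_exp:
  assumes "diffk k u" shows "diffk k (\<lambda>x. exp (u x))"
  by (rule diffk_compose[where f = "\<lambda>_::unit. exp" and f' = "\<lambda>_ s. exp s" and I = UNIV, OF assms])
    (auto intro!: derivative_eq_intros)

lemma smooth_fun_norm_diff_power2:
  "smooth_fun (\<lambda>x. c + a * (norm (x - y))\<^sup>2)"
  unfolding smooth_fun_iff_diffk
proof
  fix k
  have eq: "c + a * (norm (x - y))\<^sup>2 = c + a * (\<Sum>b\<in>Basis. (x \<bullet> b + (- (y \<bullet> b))) * (x \<bullet> b + (- (y \<bullet> b))))" for x
    unfolding power2_norm_eq_inner by (subst euclidean_inner) (simp add: inner_diff_left)
  show "diffk k (\<lambda>x. c + a * (norm (x - y))\<^sup>2)"
    unfolding eq by (intro diffk_add diffk_mult diffk_sum diffk_const diffk_inner_left)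
qed

lemma norm_diff_power2_has_derivative:
  "((\<lambda>x. c + a * (norm (x - y))\<^sup>2) has_derivative (\<lambda>h. (2 * a) *\<^sub>R (x - y) \<bullet> h)) (at x)"
  unfolding power2_norm_eq_inner
  by (auto intro!: derivative_eq_intros simp: inner_commute algebra_simps)

section \<open>The flat function exp(-1/s) and its derivatives\<close>

definition flat_exp :: "nat \<Rightarrow> real \<Rightarrow> real" where
  "flat_exp j s = (if s > 0 then inverse s ^ j * exp (- inverse s) else 0)"

lemma flat_exp_tendsto_0: "(flat_exp j \<longlongrightarrow> 0) (at 0)"
proof -
  have "((\<lambda>s. inverse s ^ j * exp (- inverse s)) \<longlongrightarrow> 0) (at_right (0::real))"
    by (rule filterlim_compose[OF _ filterlim_inverse_at_top_right, where g = "\<lambda>s. s ^ j * exp (- s)"])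
      (use tendsto_power_div_exp_0[of j] in \<open>simp add: exp_minus field_simps\<close>)
  then have r: "(flat_exp j \<longlongrightarrow> 0) (at_right 0)"
    by (rule Lim_transform_eventually)
      (auto simp: flat_exp_def eventually_at_right_less intro!: eventually_at_rightI[of 0 1])
  have l: "(flat_exp j \<longlongrightarrow> 0) (at_left 0)"
    by (rule Lim_transform_eventually[OF tendsto_const])
      (auto simp: flat_exp_def intro!: eventually_at_leftI[of "-1" 0])
  show ?thesis using l r filterlim_split_at by blast
qed

text \<open>Differentiating exp(-1/s) produces powers of 1/s; carrying the exponent \<open>j\<close>
  along makes the family closed under differentiation up to linear combinations. The bump is built
  on \<open>j = 0\<close>.\<close>

lemma flat_exp_has_real_derivative:
  "(flat_exp j has_real_derivative (flat_exp (j + 2) s - real j * flat_exp (j + 1) s)) (at s)"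
proof -
  consider "s > 0" | "s < 0" | "s = 0" by linarith
  then show ?thesis
  proof cases
    case 1
    have j: "real j * inverse s ^ (j - 1) * (inverse s)\<^sup>2 = real j * inverse s ^ (j + 1)"
      by (cases j) (simp_all add: power2_eq_square)
    have i: "(inverse has_real_derivative - (inverse s)\<^sup>2) (at s)"
      using 1 DERIV_inverse[of s UNIV] by (simp add: numeral_2_eq_2)
    have "((\<lambda>s. inverse s ^ j * exp (- inverse s)) has_real_derivative
        inverse s ^ j * (exp (- inverse s) * (inverse s)\<^sup>2) -
        real j * inverse s ^ (j - 1) * (inverse s)\<^sup>2 * exp (- inverse s)) (at s)"
      by (rule derivative_eq_intros i refl | simp)+
    then have "((\<lambda>s. inverse s ^ j * exp (- inverse s)) has_real_derivative
        (flat_exp (j + 2) s - real j * flat_exp (j + 1) s)) (at s)"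
      unfolding j using 1 by (simp add: flat_exp_def power_add power2_eq_square mult_ac)
    then show ?thesis
      by (rule DERIV_cong_ev[THEN iffD1, rotated -1])
        (use 1 in \<open>auto simp: flat_exp_def intro!: eventually_nhds_in_open[of "{0<..}", THEN eventually_mono]\<close>)
  next
    case 2
    have "((\<lambda>s. 0) has_real_derivative (flat_exp (j + 2) s - real j * flat_exp (j + 1) s)) (at s)"
      using 2 by (simp add: flat_exp_def)
    then show ?thesis
      by (rule DERIV_cong_ev[THEN iffD1, rotated -1])
        (use 2 in \<open>auto simp: flat_exp_def intro!: eventually_nhds_in_open[of "{..<0}", THEN eventually_mono]\<close>)
  next
    case 3
    \<comment> \<open>Division by \<open>h\<close> merely raises the power of 1/h by one, so the
      difference quotient at 0 is the next member of the family, which tends to 0.\<close>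
    have "(flat_exp j (0 + h) - flat_exp j 0) / h = flat_exp (j + 1) h" for h
      by (simp add: flat_exp_def field_simps)
    moreover have "flat_exp i 0 = 0" for i
      by (simp add: flat_exp_def)
    ultimately show ?thesis
      unfolding DERIV_def 3 using flat_exp_tendsto_0[of "j + 1"] by simp
  qed
qed

lemma smooth_fun_flat_exp:
  assumes "smooth_fun u" shows "smooth_fun (\<lambda>x. flat_exp j (u x))"
  unfolding smooth_fun_iff_diffk
proof
  fix k
  show "diffk k (\<lambda>x. flat_exp j (u x))"
  proof (rule diffk_compose[where f = flat_exp and I = UNIV,
          where f' = "\<lambda>j s. flat_exp (j + 2) s + (- real j) * flat_exp (j + 1) s"])
    show "diffk k u" using assms by (simp add: smooth_fun_iff_diffk)
    show "(flat_exp i has_real_derivative flat_exp (i + 2) s + (- real i) * flat_exp (i + 1) s) (at s)" for i s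
      using flat_exp_has_real_derivative[of i s] by simp
    show "diffk k (\<lambda>x. flat_exp (i + 2) (u x) + (- real i) * flat_exp (i + 1) (u x))"
      if "\<And>j. j \<in> UNIV \<Longrightarrow> diffk k (\<lambda>x. flat_exp j (u x))" for i k and u :: "'a \<Rightarrow> real"
      by (intro diffk_add diffk_mult diffk_const that UNIV_I)
  qed auto
qed

subsection \<open>Integration on the whole space\<close>

text \<open>The mean value bound dominates all difference quotients by \<open>B\<close>, so
  dominated convergence applies along every sequence tending to \<open>t\<close>.\<close>

lemma has_real_derivative_integral:
  fixes F :: "real \<Rightarrow> 'a \<Rightarrow> real"
  assumes e: "e > 0"
    and int: "\<And>s. s \<in> ball t e \<Longrightarrow> integrable M (F s)"
    and der: "\<And>s x. s \<in> ball t e \<Longrightarrow> x \<in> space M \<Longrightarrow>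
      ((\<lambda>s. F s x) has_real_derivative F' s x) (at s)"
    and bound: "\<And>s x. s \<in> ball t e \<Longrightarrow> x \<in> space M \<Longrightarrow> \<bar>F' s x\<bar> \<le> B x"
    and B: "integrable M B"
    and meas: "F' t \<in> borel_measurable M"
  shows "((\<lambda>s. LINT x|M. F s x) has_real_derivative (LINT x|M. F' t x)) (at t)"
  unfolding has_field_derivative_iff tendsto_at_iff_sequentially
proof (intro allI impI)
  fix X :: "nat \<Rightarrow> real"
  assume X: "\<forall>i. X i \<in> UNIV - {t}" and "X \<longlonglongrightarrow> t"
  then have "\<forall>\<^sub>F i in sequentially. dist (X i) t < e"
    using e tendstoD by blast
  then obtain N where N: "\<And>i. i \<ge> N \<Longrightarrow> X i \<in> ball t e"
    by (auto simp: eventually_sequentially dist_commute)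
  \<comment> \<open>Dropping the first \<open>N\<close> terms keeps every argument in the ball on
    which the bounds hold; \<open>LIMSEQ_offset\<close> undoes the shift at the end.\<close>
  define Y where "Y i = X (i + N)" for i
  have Y: "Y i \<in> ball t e" "Y i \<noteq> t" for i
    using N X by (auto simp: Y_def)
  have Yt: "Y \<longlonglongrightarrow> t"
    unfolding Y_def using \<open>X \<longlonglongrightarrow> t\<close> by (rule LIMSEQ_ignore_initial_segment)
  have t: "t \<in> ball t e" using e by simp
  define q where "q i x = (F (Y i) x - F t x) / (Y i - t)" for i x
  have "(\<lambda>i. LINT x|M. q i x) \<longlonglongrightarrow> (LINT x|M. F' t x)"
  proof (rule integral_dominated_convergence[where w = B])
    show "q i \<in> borel_measurable M" for i
      using int[OF Y(1)[of i]] int[OF t] unfolding q_def by simp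
    show "AE x in M. (\<lambda>i. q i x) \<longlonglongrightarrow> F' t x"
    proof (intro AE_I2)
      fix x assume "x \<in> space M"
      then have "((\<lambda>s. (F s x - F t x) / (s - t)) \<longlongrightarrow> F' t x) (at t)"
        using der[OF t] by (simp add: has_field_derivative_iff)
      then show "(\<lambda>i. q i x) \<longlonglongrightarrow> F' t x"
        using Yt Y(2) unfolding q_def tendsto_at_iff_sequentially by (auto simp: o_def)
    qed
    show "AE x in M. norm (q i x) \<le> B x" for i
    proof (intro AE_I2)
      fix x assume x: "x \<in> space M"
      have "norm (F (Y i) x - F t x) \<le> B x * norm (Y i - t)"
        by (rule field_differentiable_bound[where S = "ball t e" and f' = "\<lambda>s. F' s x"])
          (use der bound x Y t in \<open>auto intro: has_field_derivative_at_within\<close>)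
      then show "norm (q i x) \<le> B x"
        using Y(2)[of i] by (simp add: q_def field_simps)
    qed
  qed (use B meas in auto)
  moreover have "(LINT x|M. q i x) = ((LINT x|M. F (Y i) x) - (LINT x|M. F t x)) / (Y i - t)" for i
    unfolding q_def using int[OF Y(1)] int[OF t] by simp
  ultimately have "(\<lambda>i. ((LINT x|M. F (X (i + N)) x) - (LINT x|M. F t x)) / (X (i + N) - t))
      \<longlonglongrightarrow> (LINT x|M. F' t x)"
    by (simp add: Y_def)
  then show "((\<lambda>s. ((LINT x|M. F s x) - (LINT x|M. F t x)) / (s - t)) \<circ> X)
      \<longlonglongrightarrow> (LINT x|M. F' t x)"
    unfolding o_def by (rule LIMSEQ_offset)
qed

lemma
  fixes f :: "'a::euclidean_space \<Rightarrow> real"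
  assumes f: "f \<in> borel_measurable borel" and c: "c \<noteq> 0"
  shows integrable_lborel_affine_iff:
      "integrable lborel (\<lambda>x. f (t + c *\<^sub>R x)) \<longleftrightarrow> integrable lborel f"
    and integral_lborel_affine:
      "(LINT x|lborel. f x) = \<bar>c\<bar> ^ DIM('a) * (LINT x|lborel. f (t + c *\<^sub>R x))"
proof -
  have [measurable]: "f \<in> borel_measurable borel" by fact
  show "integrable lborel (\<lambda>x. f (t + c *\<^sub>R x)) \<longleftrightarrow> integrable lborel f"
    using c by (subst (2) lborel_affine[OF c, of t]) (simp add: integrable_density integrable_distr_eq)
  show "(LINT x|lborel. f x) = \<bar>c\<bar> ^ DIM('a) * (LINT x|lborel. f (t + c *\<^sub>R x))"
    by (subst lborel_affine[OF c, of t]) (simp add: integral_density integral_distr)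
qed

lemma integrable_lborel_continuous_compact_support:
  fixes f :: "'a::euclidean_space \<Rightarrow> real"
  assumes "continuous_on UNIV f" "compact K" "\<And>x. x \<notin> K \<Longrightarrow> f x = 0"
  shows "integrable lborel f"
proof -
  have "integrable lborel (\<lambda>x. indicator K x *\<^sub>R f x)"
    using assms by (intro borel_integrable_compact) (auto intro: continuous_on_subset)
  moreover have "(\<lambda>x. indicator K x *\<^sub>R f x) = f"
    using assms(3) by (auto simp: indicator_def fun_eq_iff)
  ultimately show ?thesis by simp
qed

text \<open>By translation invariance the integral of f(x + s b) does not depend on
  \<open>s\<close>; differentiating under the integral sign at s = 0 gives the claim.\<close>

lemma integral_partial_eq_0:
  fixes f :: "'a::euclidean_space \<Rightarrow> real"
  assumes der: "\<And>x. (f has_derivative D x) (at x)"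
    and cont: "continuous_on UNIV (\<lambda>x. D x b)"
    and K: "compact K" "\<And>x. x \<notin> K \<Longrightarrow> f x = 0"
  shows "(LINT x|lborel. D x b) = 0"
proof -
  have D0: "D x b = 0" if "x \<notin> K" for x
  proof -
    have "((\<lambda>x. 0) has_derivative D x) (at x)"
      by (rule has_derivative_transform_within_open[OF der, of "- K"])
        (use K that compact_imp_closed in auto)
    then have "D x = (\<lambda>h. 0)"
      using has_derivative_unique has_derivative_const by blast
    then show ?thesis by simp
  qed
  have fcont: "continuous_on UNIV f"
    using der by (meson continuous_at_imp_continuous_on has_derivative_continuous)
  then have fm: "f \<in> borel_measurable borel" by (rule borel_measurable_continuous_onI)
  have "compact ((\<lambda>x. D x b) ` K)"
    using K cont continuous_on_subset compact_continuous_image by blast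
  then obtain C where C: "\<And>x. x \<in> K \<Longrightarrow> \<bar>D x b\<bar> \<le> C" "C > 0"
    using compact_imp_bounded bounded_pos by (metis image_eqI real_norm_def)
  obtain R where R: "\<And>x. x \<in> K \<Longrightarrow> norm x \<le> R"
    using K compact_imp_bounded bounded_iff by metis
  \<comment> \<open>For |s| < 1 a point whose translate hits \<open>K\<close> lies in this ball, so
    the constant \<open>C\<close> on it dominates the derivative for all such \<open>s\<close> at
    once.\<close>
  let ?B = "cball 0 (R + norm b) :: 'a set"
  have shift: "(LINT x|lborel. f (x + s *\<^sub>R b)) = (LINT x|lborel. f x)"
      "integrable lborel (\<lambda>x. f (x + s *\<^sub>R b))" for s
    using integral_lborel_affine[OF fm, of 1 "s *\<^sub>R b"]
      integrable_lborel_affine_iff[OF fm, of 1 "s *\<^sub>R b"]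
      integrable_lborel_continuous_compact_support[OF fcont K]
    by (simp_all add: add.commute)
  have "((\<lambda>s. LINT x|lborel. f (x + s *\<^sub>R b)) has_real_derivative
      (LINT x|lborel. D (x + 0 *\<^sub>R b) b)) (at 0)"
  proof (rule has_real_derivative_integral[where e = 1 and B = "\<lambda>x. indicator ?B x *\<^sub>R C"])
    fix s :: real and x assume s: "s \<in> ball 0 1"
    show "((\<lambda>s. f (x + s *\<^sub>R b)) has_real_derivative D (x + s *\<^sub>R b) b) (at s)"
    proof -
      have "((\<lambda>s. f (x + s *\<^sub>R b)) has_derivative (\<lambda>h. D (x + s *\<^sub>R b) (h *\<^sub>R b))) (at s)"
        by (rule has_derivative_compose[OF _ der]) (auto intro!: derivative_eq_intros)
      moreover have "D (x + s *\<^sub>R b) (h *\<^sub>R b) = D (x + s *\<^sub>R b) b * h" for h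
        using der[THEN has_derivative_bounded_linear] by (simp add: linear_cmul bounded_linear.linear)
      ultimately show ?thesis
        by (simp add: has_field_derivative_def)
    qed
    show "\<bar>D (x + s *\<^sub>R b) b\<bar> \<le> indicator ?B x *\<^sub>R C"
    proof (cases "x + s *\<^sub>R b \<in> K")
      case True
      have "norm x \<le> norm (x + s *\<^sub>R b) + norm (s *\<^sub>R b)"
        using norm_triangle_ineq4[of "x + s *\<^sub>R b" "s *\<^sub>R b"] by simp
      also have "\<dots> \<le> R + 1 * norm b"
        using s True by (intro add_mono R) (auto intro!: mult_left_le_one_le)
      finally show ?thesis using C(1)[OF True] by simp
    qed (use D0 C in auto)
  qed (use shift cont emeasure_lborel_cball_finite in
      \<open>auto intro!: integrable_real_indicator borel_measurable_continuous_onI\<close>)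
  then have "((\<lambda>s. LINT x|lborel. f x) has_real_derivative (LINT x|lborel. D x b)) (at (0::real))"
    unfolding shift by simp
  then show ?thesis
    using DERIV_unique DERIV_const by blast
qed

section \<open>Green's formula against test functions\<close>

definition laplacian :: "('a::euclidean_space \<Rightarrow> real) \<Rightarrow> 'a \<Rightarrow> real" where
  "laplacian u x = (\<Sum>b\<in>Basis. frechet_derivative (\<lambda>z. frechet_derivative u (at z) b) (at x) b)"

lemma continuous_on_laplacian: "smooth_fun u \<Longrightarrow> continuous_on A (laplacian u)"
  unfolding laplacian_def[abs_def]
  by (intro continuous_intros smooth_fun_continuous_on smooth_fun_partial)

lemma gradient_inner_eq_sum:
  "gradient u x \<bullet> gradient v x =
    (\<Sum>b\<in>Basis. frechet_derivative u (at x) b * frechet_derivative v (at x) b)"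
proof -
  have "gradient u x \<bullet> b = frechet_derivative u (at x) b" if "b \<in> Basis" for b and u :: "'a \<Rightarrow> real"
    unfolding gradient_def using that by simp
  then show ?thesis
    by (subst euclidean_inner) simp
qed

lemma test_function_supportE:
  assumes "w \<in> test_functions U"
  obtains K where "compact K" "K \<subseteq> U" "\<And>x. x \<notin> K \<Longrightarrow> w x = 0"
    "\<And>x h. x \<notin> K \<Longrightarrow> frechet_derivative w (at x) h = 0" "\<And>x. x \<notin> K \<Longrightarrow> gradient w x = 0"
proof
  let ?K = "closure {x. w x \<noteq> 0}"
  show "compact ?K" "?K \<subseteq> U"
    using assms by (simp_all add: test_functions_def)
  have w: "w z = 0" if "z \<notin> ?K" for z
    using that closure_subset[of "{x. w x \<noteq> 0}"] by auto
  then show "w x = 0" if "x \<notin> ?K" for x using that .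
  have "(w has_derivative (\<lambda>h. 0)) (at x)" if "x \<notin> ?K" for x
  proof (rule has_derivative_transform_within_open[OF has_derivative_const])
    show "open (- ?K)" "x \<in> - ?K" using that by auto
    show "0 = w z" if "z \<in> - ?K" for z using w[of z] that by simp
  qed
  then show 0: "frechet_derivative w (at x) h = 0" if "x \<notin> ?K" for x h
    using frechet_derivative_at that by metis
  then show "gradient w x = 0" if "x \<notin> ?K" for x
    using that unfolding gradient_def by simp
qed

lemma test_functions_smooth: "w \<in> test_functions U \<Longrightarrow> smooth_fun w"
  by (simp add: test_functions_def)

lemma integral_lebesgue_on_eq_lborel:
  fixes f :: "'a::euclidean_space \<Rightarrow> real"
  assumes "f \<in> borel_measurable borel" "U \<in> sets lebesgue" "\<And>x. x \<notin> U \<Longrightarrow> f x = 0"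
  shows "(LINT x|lebesgue_on U. f x) = (LINT x|lborel. f x)"
proof -
  have "(LINT x|lebesgue_on U. f x) = (LINT x|lebesgue. indicator U x *\<^sub>R f x)"
    using assms by (intro integral_restrict_space) auto
  also have "(\<lambda>x. indicator U x *\<^sub>R f x) = f"
    using assms by (auto simp: indicator_def fun_eq_iff)
  also have "(LINT x|lebesgue. f x) = (LINT x|lborel. f x)"
    using assms by (intro integral_completion) simp
  finally show ?thesis .
qed

text \<open>Apply the vanishing of integrated derivatives to \<open>w\<close> times each partial
  derivative of \<psi> and sum over the basis. The compact support of \<open>w\<close> removes all
  boundary terms, whatever \<psi> does at the boundary.\<close>

lemma integral_gradient_test_function:
  fixes w :: "'a::euclidean_space \<Rightarrow> real"
  assumes w: "w \<in> test_functions U" and psi: "smooth_fun \<psi>" and U: "U \<in> sets lebesgue"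
  shows "(LINT x|lebesgue_on U. gradient w x \<bullet> gradient \<psi> x) =
    - (LINT x|lebesgue_on U. w x * laplacian \<psi> x)"
proof -
  have sw: "smooth_fun w" using w by (simp add: test_functions_def)
  obtain K where K: "compact K" "K \<subseteq> U" and K0: "\<And>x. x \<notin> K \<Longrightarrow> w x = 0"
    "\<And>x h. x \<notin> K \<Longrightarrow> frechet_derivative w (at x) h = 0" "\<And>x. x \<notin> K \<Longrightarrow> gradient w x = 0"
    using test_function_supportE[OF w] by blast
  let ?d = "\<lambda>u b x. frechet_derivative u (at x) b"
  note cont = smooth_fun_continuous_on smooth_fun_partial sw psi
  have "(LINT x|lborel. w x * ?d (?d \<psi> b) b x + ?d w b x * ?d \<psi> b x) = 0" if b: "b \<in> Basis" for b
  proof (rule integral_partial_eq_0[where K = K and b = b and f = "\<lambda>x. w x * ?d \<psi> b x" and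
      D = "\<lambda>x h. w x * ?d (?d \<psi> b) h x + ?d w h x * ?d \<psi> b x"])
    show "((\<lambda>x. w x * ?d \<psi> b x) has_derivative
        (\<lambda>h. w x * ?d (?d \<psi> b) h x + ?d w h x * ?d \<psi> b x)) (at x)" for x
      by (rule has_derivative_mult smooth_fun_has_derivative cont b)+
    show "continuous_on UNIV (\<lambda>x. w x * ?d (?d \<psi> b) b x + ?d w b x * ?d \<psi> b x)"
      by (intro continuous_intros cont b)
  qed (use K K0 in auto)
  moreover have i1: "integrable lborel (\<lambda>x. w x * ?d (?d \<psi> b) b x)" if b: "b \<in> Basis" for b
    by (rule integrable_lborel_continuous_compact_support[OF _ K(1)], intro continuous_intros cont b)
      (simp add: K0)
  moreover have i2: "integrable lborel (\<lambda>x. ?d w b x * ?d \<psi> b x)" if b: "b \<in> Basis" for b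
    by (rule integrable_lborel_continuous_compact_support[OF _ K(1)], intro continuous_intros cont b)
      (simp add: K0)
  ultimately have 1: "(LINT x|lborel. ?d w b x * ?d \<psi> b x) = - (LINT x|lborel. w x * ?d (?d \<psi> b) b x)"
    if b: "b \<in> Basis" for b
    using b by (simp add: add_eq_0_iff)
  have "(LINT x|lebesgue_on U. gradient w x \<bullet> gradient \<psi> x) = (LINT x|lborel. gradient w x \<bullet> gradient \<psi> x)"
    using K0 K
    by (intro integral_lebesgue_on_eq_lborel U borel_measurable_continuous_onI continuous_on_inner
          continuous_on_gradient sw psi) (metis inner_zero_left subsetD)
  also have "\<dots> = (\<Sum>b\<in>Basis. LINT x|lborel. ?d w b x * ?d \<psi> b x)"
    using i2 by (subst Bochner_Integration.integral_sum[symmetric])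
      (auto simp: gradient_inner_eq_sum)
  also have "\<dots> = - (LINT x|lborel. w x * laplacian \<psi> x)"
    unfolding laplacian_def sum_distrib_left using i1 1
    by (subst Bochner_Integration.integral_sum) (auto simp: sum_negf)
  also have "(LINT x|lborel. w x * laplacian \<psi> x) = (LINT x|lebesgue_on U. w x * laplacian \<psi> x)"
    using K0 K
    by (intro integral_lebesgue_on_eq_lborel[symmetric] U borel_measurable_continuous_onI continuous_on_mult
          continuous_on_laplacian smooth_fun_continuous_on sw psi) (metis mult_zero_left subsetD)
  finally show ?thesis .
qed

text \<open>Cauchy-Schwarz, with the change of the integrand bounded by a factor tending to 0 in L2
  times a fixed L2 factor. The pointwise form of the bound covers integrands linear in the
  approximants as well as Lipschitz functions of them.\<close>

lemma tendsto_integral_L2: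
  fixes f :: "nat \<Rightarrow> 'a \<Rightarrow> real"
  assumes "\<And>k. integrable M (f k)" "integrable M F"
    and a: "\<And>k. a k \<in> borel_measurable M" and b: "b \<in> borel_measurable M"
    and le: "\<And>k x. x \<in> space M \<Longrightarrow> \<bar>f k x - F x\<bar> \<le> \<bar>a k x\<bar> * \<bar>b x\<bar>"
    and lim: "(\<lambda>k. \<integral>\<^sup>+x. ennreal ((a k x)\<^sup>2) \<partial>M) \<longlonglongrightarrow> 0"
    and fin: "(\<integral>\<^sup>+x. ennreal ((b x)\<^sup>2) \<partial>M) < \<infinity>"
  shows "(\<lambda>k. LINT x|M. f k x) \<longlonglongrightarrow> (LINT x|M. F x)"
proof (rule tendsto_L1_int[OF assms(1,2)])
  have sq: "(ennreal \<bar>r\<bar>)\<^sup>2 = ennreal (r\<^sup>2)" for r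
    by (simp add: ennreal_power)
  have bound: "(\<integral>\<^sup>+x. norm (f k x - F x) \<partial>M)\<^sup>2 \<le>
      (\<integral>\<^sup>+x. ennreal ((b x)\<^sup>2) \<partial>M) * (\<integral>\<^sup>+x. ennreal ((a k x)\<^sup>2) \<partial>M)" for k
  proof -
    have "(\<integral>\<^sup>+x. norm (f k x - F x) \<partial>M) \<le> (\<integral>\<^sup>+x. ennreal \<bar>a k x\<bar> * ennreal \<bar>b x\<bar> \<partial>M)"
      using le by (intro nn_integral_mono) (auto simp: ennreal_mult[symmetric] intro!: ennreal_leI)
    then have "(\<integral>\<^sup>+x. norm (f k x - F x) \<partial>M)\<^sup>2 \<le> (\<integral>\<^sup>+x. ennreal \<bar>a k x\<bar> * ennreal \<bar>b x\<bar> \<partial>M)\<^sup>2"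
      by (intro power_mono) auto
    also have "\<dots> \<le> (\<integral>\<^sup>+x. (ennreal \<bar>a k x\<bar>)\<^sup>2 \<partial>M) * (\<integral>\<^sup>+x. (ennreal \<bar>b x\<bar>)\<^sup>2 \<partial>M)"
      using a b by (intro Cauchy_Schwarz_nn_integral) auto
    finally show ?thesis by (simp only: sq mult.commute)
  qed
  have "(\<lambda>k. (\<integral>\<^sup>+x. ennreal ((b x)\<^sup>2) \<partial>M) * (\<integral>\<^sup>+x. ennreal ((a k x)\<^sup>2) \<partial>M)) \<longlonglongrightarrow>
      (\<integral>\<^sup>+x. ennreal ((b x)\<^sup>2) \<partial>M) * 0"
    using lim fin by (intro ennreal_tendsto_cmult) auto
  then have sq0: "(\<lambda>k. (\<integral>\<^sup>+x. norm (f k x - F x) \<partial>M)\<^sup>2) \<longlonglongrightarrow> 0"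
    using tendsto_sandwich[OF always_eventually[OF allI[OF zero_le]] always_eventually[OF allI[OF bound]] tendsto_const]
    by simp
  show "(\<lambda>k. \<integral>\<^sup>+x. norm (f k x - F x) \<partial>M) \<longlonglongrightarrow> 0"
  \<comment> \<open>Comparing squares with r^2 passes from the squared integrals to the integrals
    themselves without a square root on extended reals.\<close>
  proof (rule tendsto_zero_ennreal)
    fix r :: real assume r: "0 < r"
    then have "\<forall>\<^sub>F k in sequentially. (\<integral>\<^sup>+x. norm (f k x - F x) \<partial>M)\<^sup>2 < (ennreal r)\<^sup>2"
      by (intro order_tendstoD(2)[OF sq0]) (simp add: ennreal_power)
    then show "\<forall>\<^sub>F k in sequentially. (\<integral>\<^sup>+x. norm (f k x - F x) \<partial>M) < ennreal r"
      by eventually_elim (meson linorder_not_le power_mono zero_le)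
  qed
qed

text \<open>The integrand is a product of one-dimensional Gaussians of variance 2 up to
  normalization, so Tonelli reduces the claim to the normal density.\<close>

lemma integrable_gaussian: "integrable lborel (\<lambda>z::'a::euclidean_space. exp (- (norm z)\<^sup>2 / 4))"
proof (rule integrableI_nonneg)
  have "(\<integral>\<^sup>+z. ennreal (exp (- (norm z)\<^sup>2 / 4)) \<partial>(lborel :: 'a measure)) =
      (\<integral>\<^sup>+z. (\<Prod>b\<in>Basis. ennreal (exp (- (z \<bullet> b)\<^sup>2 / 4))) \<partial>(lborel :: 'a measure))"
  proof (intro nn_integral_cong)
    fix z :: 'a
    have "- (norm z)\<^sup>2 / 4 = (\<Sum>b\<in>Basis. - (z \<bullet> b)\<^sup>2 / 4)"
      unfolding power2_norm_eq_inner
      by (subst euclidean_inner) (simp add: sum_divide_distrib sum_negf power2_eq_square)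
    then show "ennreal (exp (- (norm z)\<^sup>2 / 4)) = (\<Prod>b\<in>Basis. ennreal (exp (- (z \<bullet> b)\<^sup>2 / 4)))"
      by (simp add: exp_sum prod_ennreal)
  qed
  also have "\<dots> = (\<Prod>b\<in>(Basis::'a set). (\<integral>\<^sup>+x. ennreal (exp (- x\<^sup>2 / 4)) \<partial>lborel))"
    by (rule nn_integral_lborel_prod[where f = "\<lambda>b x. ennreal (exp (- x\<^sup>2 / 4))"]) auto
  also have "\<dots> < \<infinity>"
  proof -
    have "integrable lborel (\<lambda>x::real. sqrt (2 * pi * (sqrt 2)\<^sup>2) * normal_density 0 (sqrt 2) x)"
      by (intro integrable_mult_right integrable_normal_density) simp
    then have "integrable lborel (\<lambda>x::real. exp (- x\<^sup>2 / 4))"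
      by (simp add: normal_density_def)
    then have "(\<integral>\<^sup>+x. ennreal (exp (- x\<^sup>2 / 4)) \<partial>(lborel :: real measure)) < \<infinity>"
      by (subst nn_integral_eq_integral) auto
    then show ?thesis
      by (simp add: prod_constant power_less_top_ennreal)
  qed
  finally show "(\<integral>\<^sup>+z. ennreal (exp (- (norm z)\<^sup>2 / 4)) \<partial>(lborel :: 'a measure)) < \<infinity>" .
qed auto

subsection \<open>The subsolution inequality\<close>

lemma tanh_lipschitz: "\<bar>tanh a - tanh b\<bar> \<le> \<bar>a - b\<bar>" for a b :: real
proof -
  have "norm (tanh a - tanh b) \<le> 1 * norm (a - b)"
  proof (rule field_differentiable_bound[where S = UNIV and f' = "\<lambda>s. 1 - (tanh s)\<^sup>2"])
    show "norm (1 - (tanh s)\<^sup>2) \<le> 1" for s :: real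
      using tanh_real_bounds[of s] by (simp add: abs_square_le_1 abs_le_iff)
  qed (auto intro!: derivative_eq_intros)
  then show ?thesis by simp
qed

text \<open>Serves the square integrability of \<open>u\<close> and of its weak gradient: each
  differs from a bounded approximant by an L2 function, and constants are in L2 on a set of finite
  measure.\<close>

lemma (in finite_measure) nn_integral_power2_finite_bounded_diff:
  assumes [measurable]: "a \<in> borel_measurable M"
    and fin: "(\<integral>\<^sup>+x. ennreal ((a x)\<^sup>2) \<partial>M) < \<infinity>"
    and le: "\<And>x. x \<in> space M \<Longrightarrow> \<bar>f x\<bar> \<le> \<bar>a x\<bar> + C"
  shows "(\<integral>\<^sup>+x. ennreal ((f x)\<^sup>2) \<partial>M) < \<infinity>"
proof -
  have "(\<integral>\<^sup>+x. ennreal ((f x)\<^sup>2) \<partial>M) \<le> (\<integral>\<^sup>+x. ennreal 2 * ennreal ((a x)\<^sup>2) + ennreal (2 * C\<^sup>2) \<partial>M)"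
  proof (rule nn_integral_mono)
    fix x assume x: "x \<in> space M"
    have "(f x)\<^sup>2 \<le> (\<bar>a x\<bar> + C)\<^sup>2"
      using le[OF x] by (metis abs_ge_zero order.trans power2_abs power_mono)
    also have "\<dots> \<le> 2 * (a x)\<^sup>2 + 2 * C\<^sup>2"
      using sum_squares_bound[of "\<bar>a x\<bar>" C] by (simp add: power2_sum)
    finally show "ennreal ((f x)\<^sup>2) \<le> ennreal 2 * ennreal ((a x)\<^sup>2) + ennreal (2 * C\<^sup>2)"
      by (simp flip: ennreal_mult ennreal_plus add: ennreal_leI del: ennreal_numeral)
  qed
  also have "\<dots> = ennreal 2 * (\<integral>\<^sup>+x. ennreal ((a x)\<^sup>2) \<partial>M) + ennreal (2 * C\<^sup>2) * emeasure M (space M)"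
    by (simp add: nn_integral_add nn_integral_cmult del: ennreal_numeral)
  also have "\<dots> < \<infinity>"
    using fin emeasure_finite[of "space M"] by (simp add: ennreal_mult_eq_top_iff less_top[symmetric])
  finally show ?thesis .
qed

lemma integrable_L2_mult:
  fixes f :: "'a \<Rightarrow> real"
  assumes [measurable]: "a \<in> borel_measurable M" "b \<in> borel_measurable M" "f \<in> borel_measurable M"
    and a: "(\<integral>\<^sup>+x. ennreal ((a x)\<^sup>2) \<partial>M) < \<infinity>" and b: "(\<integral>\<^sup>+x. ennreal ((b x)\<^sup>2) \<partial>M) < \<infinity>"
    and le: "\<And>x. x \<in> space M \<Longrightarrow> \<bar>f x\<bar> \<le> \<bar>a x\<bar> * \<bar>b x\<bar>"
  shows "integrable M f"
proof (rule integrableI_bounded)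
  have "(\<integral>\<^sup>+x. ennreal (norm (f x)) \<partial>M) \<le> (\<integral>\<^sup>+x. ennreal ((a x)\<^sup>2) + ennreal ((b x)\<^sup>2) \<partial>M)"
  proof (rule nn_integral_mono)
    fix x assume x: "x \<in> space M"
    have "2 * (\<bar>a x\<bar> * \<bar>b x\<bar>) \<le> (a x)\<^sup>2 + (b x)\<^sup>2"
      using sum_squares_bound[of "\<bar>a x\<bar>" "\<bar>b x\<bar>"] by (simp add: mult.assoc)
    moreover have "0 \<le> \<bar>a x\<bar> * \<bar>b x\<bar>" by simp
    ultimately have "\<bar>f x\<bar> \<le> (a x)\<^sup>2 + (b x)\<^sup>2"
      using le[OF x] by linarith
    then show "ennreal (norm (f x)) \<le> ennreal ((a x)\<^sup>2) + ennreal ((b x)\<^sup>2)"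
      by (simp flip: ennreal_plus add: ennreal_leI)
  qed
  also have "\<dots> < \<infinity>"
    using a b by (simp add: nn_integral_add)
  finally show "(\<integral>\<^sup>+x. ennreal (norm (f x)) \<partial>M) < \<infinity>" .
qed fact

text \<open>The weak gradient, existentially quantified for eigenfunctions, becomes a parameter, so
  that all estimates refer to the same \<open>g\<close>.\<close>

locale positive_dirichlet_solution =
  fixes \<Omega> :: "'a::euclidean_space set" and u :: "'a \<Rightarrow> real" and g :: "'a \<Rightarrow> 'a" and l :: real
  assumes open_domain: "open \<Omega>" and bounded_domain: "bounded \<Omega>"
    and H10: "H10 \<Omega> u g"
    and weak_eq: "\<And>v. v \<in> test_functions \<Omega> \<Longrightarrow>
      (LINT x|lebesgue_on \<Omega>. g x \<bullet> gradient v x) = l * (LINT x|lebesgue_on \<Omega>. u x * v x)"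
    and cont: "continuous_on \<Omega> u"
    and pos: "\<And>x. x \<in> \<Omega> \<Longrightarrow> u x > 0"
begin

abbreviation "M \<equiv> lebesgue_on \<Omega>"

sublocale finite_measure M
  using lmeasurable_open[OF bounded_domain open_domain] by (rule finite_measure_lebesgue_on)

lemma domain_sets: "\<Omega> \<in> sets lebesgue"
  using open_domain by simp

lemma borel_measurable_M:
  fixes f :: "'a \<Rightarrow> 'b::topological_space"
  assumes "continuous_on UNIV f" shows "f \<in> borel_measurable M"
  using assms
  by (intro measurable_restrict_space1 measurable_completion) (simp add: borel_measurable_continuous_onI)

lemma bounded_on_domain:
  fixes f :: "'a \<Rightarrow> 'b::real_normed_vector"
  assumes "continuous_on UNIV f"
  obtains C where "C > 0" "\<And>x. x \<in> \<Omega> \<Longrightarrow> norm (f x) \<le> C"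
proof -
  have "compact (f ` closure \<Omega>)"
    using assms bounded_domain
    by (intro compact_continuous_image) (auto intro: continuous_on_subset)
  then obtain C where "C > 0" "\<And>x. x \<in> closure \<Omega> \<Longrightarrow> norm (f x) \<le> C"
    using compact_imp_bounded bounded_pos by (metis image_eqI)
  then show ?thesis
    using that closure_subset by blast
qed

lemma u_measurable [measurable]: "u \<in> borel_measurable M"
  and g_measurable [measurable]: "g \<in> borel_measurable M"
  using H10 by (auto simp: H10_def)

definition w :: "nat \<Rightarrow> 'a \<Rightarrow> real" where
  "w = (SOME w. (\<forall>k. w k \<in> test_functions \<Omega>) \<and>
        (\<lambda>k. \<integral>\<^sup>+x. ennreal ((w k x - u x)\<^sup>2) \<partial>M) \<longlonglongrightarrow> 0 \<and>
        (\<lambda>k. \<integral>\<^sup>+x. ennreal ((norm (gradient (w k) x - g x))\<^sup>2) \<partial>M) \<longlonglongrightarrow> 0)"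

lemma w_test: "w k \<in> test_functions \<Omega>"
  and w_lim: "(\<lambda>k. \<integral>\<^sup>+x. ennreal ((w k x - u x)\<^sup>2) \<partial>M) \<longlonglongrightarrow> 0"
  and w_grad_lim: "(\<lambda>k. \<integral>\<^sup>+x. ennreal ((norm (gradient (w k) x - g x))\<^sup>2) \<partial>M) \<longlonglongrightarrow> 0"
  using someI_ex[OF H10[unfolded H10_def, THEN conjunct2, THEN conjunct2], folded w_def] by auto

lemma w_smooth: "smooth_fun (w k)"
  using w_test test_functions_smooth by blast

lemma w_measurable [measurable]: "w k \<in> borel_measurable M"
  and grad_w_measurable [measurable]: "gradient (w k) \<in> borel_measurable M"
  using smooth_fun_continuous_on[OF w_smooth] continuous_on_gradient[OF w_smooth]
  by (auto intro: borel_measurable_M)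

lemma u_L2: "(\<integral>\<^sup>+x. ennreal ((u x)\<^sup>2) \<partial>M) < \<infinity>"
proof -
  obtain k where k: "(\<integral>\<^sup>+x. ennreal ((w k x - u x)\<^sup>2) \<partial>M) < 1"
    using order_tendstoD(2)[OF w_lim, of 1] by (auto simp: eventually_sequentially)
  obtain C where C: "\<And>x. x \<in> \<Omega> \<Longrightarrow> norm (w k x) \<le> C"
    using bounded_on_domain[OF smooth_fun_continuous_on[OF w_smooth]] by metis
  show ?thesis
  proof (rule nn_integral_power2_finite_bounded_diff[where a = "\<lambda>x. w k x - u x" and C = C])
    show "(\<integral>\<^sup>+x. ennreal ((w k x - u x)\<^sup>2) \<partial>M) < \<infinity>"
      using k by (rule less_trans) simp
    show "\<bar>u x\<bar> \<le> \<bar>w k x - u x\<bar> + C" if "x \<in> space M" for x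
      using C[of x] that by auto
  qed simp
qed

lemma g_L2: "(\<integral>\<^sup>+x. ennreal ((norm (g x))\<^sup>2) \<partial>M) < \<infinity>"
proof -
  obtain k where k: "(\<integral>\<^sup>+x. ennreal ((norm (gradient (w k) x - g x))\<^sup>2) \<partial>M) < 1"
    using order_tendstoD(2)[OF w_grad_lim, of 1] by (auto simp: eventually_sequentially)
  obtain C where C: "\<And>x. x \<in> \<Omega> \<Longrightarrow> norm (gradient (w k) x) \<le> C"
    using bounded_on_domain[OF continuous_on_gradient[OF w_smooth]] by metis
  show ?thesis
  proof (rule nn_integral_power2_finite_bounded_diff[where a = "\<lambda>x. norm (gradient (w k) x - g x)" and C = C])
    show "(\<integral>\<^sup>+x. ennreal ((norm (gradient (w k) x - g x))\<^sup>2) \<partial>M) < \<infinity>"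
      using k by (rule less_trans) simp
    show "\<bar>norm (g x)\<bar> \<le> \<bar>norm (gradient (w k) x - g x)\<bar> + C" if "x \<in> space M" for x
      using C[of x] that norm_triangle_sub[of "g x" "gradient (w k) x"] by (auto simp: norm_minus_commute)
  qed simp
qed

lemma const_L2: "(\<integral>\<^sup>+x. ennreal (c\<^sup>2) \<partial>M) < \<infinity>"
  using emeasure_finite[of "space M"] by (simp add: ennreal_mult_eq_top_iff less_top[symmetric] del: space_restrict_space)

lemma integrable_u_mult:
  fixes p :: "'a \<Rightarrow> real"
  assumes "p \<in> borel_measurable M" "\<And>x. x \<in> \<Omega> \<Longrightarrow> \<bar>p x\<bar> \<le> C"
  shows "integrable M (\<lambda>x. u x * p x)"
  using assms(1) order_trans[OF assms(2) abs_ge_self]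
  by (intro integrable_L2_mult[OF _ _ _ u_L2 const_L2[of C]])
    (auto simp: abs_mult intro!: mult_left_mono)

lemma integrable_g_inner:
  fixes p :: "'a \<Rightarrow> 'a"
  assumes "p \<in> borel_measurable M" "\<And>x. x \<in> \<Omega> \<Longrightarrow> norm (p x) \<le> C"
  shows "integrable M (\<lambda>x. g x \<bullet> p x)"
proof (rule integrable_L2_mult[OF _ _ _ g_L2 const_L2[of C]])
  show "\<bar>g x \<bullet> p x\<bar> \<le> \<bar>norm (g x)\<bar> * \<bar>C\<bar>" if "x \<in> space M" for x
    using Cauchy_Schwarz_ineq2[of "g x" "p x"]
      mult_left_mono[OF order_trans[OF assms(2) abs_ge_self], of x "norm (g x)"] that
    by auto
qed (use assms in auto)

text \<open>The zero boundary values of \<open>u\<close> enter here: \<psi> need not vanish on the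
  boundary, yet Green's formula for the test functions \<open>w k\<close> has no boundary term, and
  both sides pass to the L2 limit.\<close>

lemma integral_g_gradient:
  assumes psi: "smooth_fun \<psi>"
  shows "(LINT x|M. g x \<bullet> gradient \<psi> x) = - (LINT x|M. u x * laplacian \<psi> x)"
proof -
  note cL = continuous_on_laplacian[OF psi] and cG = continuous_on_gradient[OF psi]
  note [measurable] = borel_measurable_M[OF cL] borel_measurable_M[OF cG]
  obtain C where C: "C > 0" "\<And>x. x \<in> \<Omega> \<Longrightarrow> norm (gradient \<psi> x) \<le> C"
    using bounded_on_domain[OF cG] by metis
  obtain C' where C': "C' > 0" "\<And>x. x \<in> \<Omega> \<Longrightarrow> norm (laplacian \<psi> x) \<le> C'"
    using bounded_on_domain[OF cL] by metis
  have "(\<lambda>k. LINT x|M. gradient (w k) x \<bullet> gradient \<psi> x) \<longlonglongrightarrow> (LINT x|M. g x \<bullet> gradient \<psi> x)"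
  proof (rule tendsto_integral_L2[OF _ _ _ _ _ w_grad_lim const_L2[of C]])
    show "integrable M (\<lambda>x. gradient (w k) x \<bullet> gradient \<psi> x)" for k
    proof -
      have c: "continuous_on UNIV (\<lambda>x. gradient (w k) x \<bullet> gradient \<psi> x)"
        by (intro continuous_intros continuous_on_gradient w_smooth psi)
      obtain B where "\<And>x. x \<in> \<Omega> \<Longrightarrow> norm (gradient (w k) x \<bullet> gradient \<psi> x) \<le> B"
        using bounded_on_domain[OF c] by metis
      then show ?thesis
        using borel_measurable_M[OF c] by (intro integrable_const_bound[of _ B]) auto
    qed
    show "\<bar>gradient (w k) x \<bullet> gradient \<psi> x - g x \<bullet> gradient \<psi> x\<bar>
        \<le> \<bar>norm (gradient (w k) x - g x)\<bar> * \<bar>C\<bar>" if "x \<in> space M" for k x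
    proof -
      have "\<bar>(gradient (w k) x - g x) \<bullet> gradient \<psi> x\<bar> \<le> norm (gradient (w k) x - g x) * norm (gradient \<psi> x)"
        by (rule Cauchy_Schwarz_ineq2)
      also have "\<dots> \<le> norm (gradient (w k) x - g x) * C"
        using C that by (intro mult_left_mono) auto
      finally show ?thesis using C(1) by (simp add: inner_diff_left)
    qed
  qed (auto intro!: integrable_g_inner[OF _ C(2)])
  moreover have "(\<lambda>k. LINT x|M. w k x * laplacian \<psi> x) \<longlonglongrightarrow> (LINT x|M. u x * laplacian \<psi> x)"
  proof (rule tendsto_integral_L2[OF _ _ _ _ _ w_lim const_L2[of C']])
    show "integrable M (\<lambda>x. w k x * laplacian \<psi> x)" for k
    proof -
      have c: "continuous_on UNIV (\<lambda>x. w k x * laplacian \<psi> x)"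
        by (intro continuous_intros smooth_fun_continuous_on w_smooth cL)
      obtain B where "\<And>x. x \<in> \<Omega> \<Longrightarrow> norm (w k x * laplacian \<psi> x) \<le> B"
        using bounded_on_domain[OF c] by metis
      then show ?thesis
        using borel_measurable_M[OF c] by (intro integrable_const_bound[of _ B]) auto
    qed
    show "\<bar>w k x * laplacian \<psi> x - u x * laplacian \<psi> x\<bar> \<le> \<bar>w k x - u x\<bar> * \<bar>C'\<bar>"
      if "x \<in> space M" for k x
      using C' that by (auto simp: left_diff_distrib[symmetric] abs_mult intro!: mult_left_mono)
  qed (use C' in \<open>auto intro!: integrable_u_mult\<close>)
  ultimately show ?thesis
    unfolding integral_gradient_test_function[OF w_test psi domain_sets]
    using LIMSEQ_unique tendsto_minus by blast
qed

text \<open>Since tanh vanishes at 0, \<open>\<psi> x * tanh (m * w k x)\<close> inherits the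
  compact support of \<open>w k\<close>; since tanh is increasing and \<psi> nonnegative,
  differentiating the tanh factor contributes with a good sign. As \<open>m\<close> is fixed,
  Lipschitz bounds turn the L2 convergence of \<open>w k\<close> into convergence of the
  integrals.\<close>

lemma subsolution_tanh:
  assumes psi: "smooth_fun \<psi>" and nonneg: "\<And>x. x \<in> \<Omega> \<Longrightarrow> \<psi> x \<ge> 0" and m: "m > 0"
  shows "(LINT x|M. g x \<bullet> (tanh (m * u x) *\<^sub>R gradient \<psi> x)) \<le> l * (LINT x|M. u x * (\<psi> x * tanh (m * u x)))"
proof -
  note cP = smooth_fun_continuous_on[OF psi] and cG = continuous_on_gradient[OF psi]
  note [measurable] = borel_measurable_M[OF cP] borel_measurable_M[OF cG]
  have tanh_meas [measurable]: "(tanh :: real \<Rightarrow> real) \<in> borel_measurable borel"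
    by (intro borel_measurable_continuous_onI continuous_on_tanh continuous_on_id) auto
  have tanh1: "\<bar>tanh s\<bar> \<le> 1" for s :: real
    using tanh_real_bounds[of s] by (auto simp: abs_le_iff)
  have tanh2: "0 \<le> 1 - (tanh s)\<^sup>2" "1 - (tanh s)\<^sup>2 \<le> 1" for s :: real
    using tanh1[of s] by (auto simp: abs_square_le_1)
  obtain C where C: "C > 0" "\<And>x. x \<in> \<Omega> \<Longrightarrow> norm (gradient \<psi> x) \<le> C"
    using bounded_on_domain[OF cG] by metis
  obtain C' where C': "C' > 0" "\<And>x. x \<in> \<Omega> \<Longrightarrow> norm (\<psi> x) \<le> C'"
    using bounded_on_domain[OF cP] by metis
  define v where "v k x = \<psi> x * tanh (m * w k x)" for k x
  \<comment> \<open>\<open>c k\<close> is the factor of \<open>gradient (w k)\<close> in the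
    gradient of \<open>v k\<close>. Its bound \<open>C' * m\<close> is uniform in \<open>k\<close>,
    which is what lets the remainder \<open>?R k\<close> vanish in the limit.\<close>
  define c where "c k x = \<psi> x * (m * (1 - (tanh (m * w k x))\<^sup>2))" for k x
  have [measurable]: "c k \<in> borel_measurable M" "v k \<in> borel_measurable M" for k
    unfolding c_def v_def by measurable
  have c: "0 \<le> c k x" "c k x \<le> C' * m" if "x \<in> \<Omega>" for k x
  proof -
    have "\<psi> x \<le> C'" using C'(2)[OF that] by simp
    then show "0 \<le> c k x" "c k x \<le> C' * m"
      using nonneg[OF that] m mult_mono[of "\<psi> x" C' "m * (1 - (tanh (m * w k x))\<^sup>2)" m] C'(1)
        tanh2[of "m * w k x"] mult_left_le[OF tanh2(2)[of "m * w k x"], of m]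
      unfolding c_def by auto
  qed
  have dv: "gradient (v k) x = tanh (m * w k x) *\<^sub>R gradient \<psi> x + c k x *\<^sub>R gradient (w k) x" for k x
  proof (rule gradient_unique)
    have t: "((\<lambda>x. tanh (m * w k x)) has_derivative
       (\<lambda>h. (1 - (tanh (m * w k x))\<^sup>2) * (m * (gradient (w k) x \<bullet> h)))) (at x)"
      by (rule has_derivative_compose[where g = tanh, OF has_derivative_mult_right[OF smooth_fun_has_derivative_gradient[OF w_smooth]]])
        (auto simp: has_field_derivative_def[symmetric] intro!: derivative_eq_intros)
    show "(v k has_derivative (\<lambda>h. (tanh (m * w k x) *\<^sub>R gradient \<psi> x + c k x *\<^sub>R gradient (w k) x) \<bullet> h)) (at x)"
      unfolding v_def[abs_def]
      by (rule has_derivative_eq_rhs[OF has_derivative_mult[OF smooth_fun_has_derivative_gradient[OF psi] t]])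
        (auto simp: fun_eq_iff c_def inner_add_left algebra_simps)
  qed
  have v_test: "v k \<in> test_functions \<Omega>" for k
  proof -
    have "smooth_fun (v k)"
      unfolding v_def[abs_def] using psi w_smooth[of k]
      by (simp add: smooth_fun_iff_diffk diffk_mult diffk_tanh diffk_const)
    moreover have sub: "closure {x. v k x \<noteq> 0} \<subseteq> closure {x. w k x \<noteq> 0}"
      by (rule closure_mono) (auto simp: v_def)
    moreover have "compact (closure {x. v k x \<noteq> 0})"
      using compact_Int_closed[OF _ closed_closure, of "closure {x. w k x \<noteq> 0}" "{x. v k x \<noteq> 0}"] w_test[of k] sub
      by (simp add: test_functions_def Int_absorb1)
    ultimately show ?thesis
      using w_test[of k] unfolding test_functions_def by blast
  qed
  let ?P = "\<lambda>k x. g x \<bullet> (tanh (m * w k x) *\<^sub>R gradient \<psi> x)"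
  let ?R = "\<lambda>k x. c k x * (g x \<bullet> (gradient (w k) x - g x))"
  have normP: "norm (tanh s *\<^sub>R gradient \<psi> x) \<le> C" if "x \<in> \<Omega>" for s x
    using mult_mono[OF tanh1[of s] C(2)[OF that]] by simp
  have absv: "\<bar>\<psi> x * tanh s\<bar> \<le> C'" if "x \<in> \<Omega>" for s x
    using mult_mono[OF C'(2)[OF that] tanh1[of s]] C'(1) by (simp add: abs_mult)
  have intP: "integrable M (?P k)" for k
    using normP by (intro integrable_g_inner[of _ C]) auto
  have intP': "integrable M (\<lambda>x. g x \<bullet> (tanh (m * u x) *\<^sub>R gradient \<psi> x))"
    using normP by (intro integrable_g_inner[of _ C]) auto
  have intV: "integrable M (\<lambda>x. u x * v k x)" for k
    using absv unfolding v_def by (intro integrable_u_mult[of _ C']) auto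
  have intV': "integrable M (\<lambda>x. u x * (\<psi> x * tanh (m * u x)))"
    using absv by (intro integrable_u_mult[of _ C']) auto
  have intcw: "integrable M (\<lambda>x. g x \<bullet> (c k x *\<^sub>R gradient (w k) x))" for k
  proof -
    obtain B where B: "\<And>x. x \<in> \<Omega> \<Longrightarrow> norm (gradient (w k) x) \<le> B"
      using bounded_on_domain[OF continuous_on_gradient[OF w_smooth]] by metis
    show ?thesis
      using c B m C' by (intro integrable_g_inner[of _ "(C' * m) * B"]) (auto intro!: mult_mono)
  qed
  have intcg: "integrable M (\<lambda>x. c k x * (g x \<bullet> g x))" for k
  proof (rule integrable_L2_mult[OF _ _ _ g_L2, where b = "\<lambda>x. (C' * m) * norm (g x)"])
    show "(\<integral>\<^sup>+ x. ennreal (((C' * m) * norm (g x))\<^sup>2) \<partial>M) < \<infinity>"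
      using g_L2 by (simp add: power_mult_distrib ennreal_mult nn_integral_cmult ennreal_mult_less_top)
    show "\<bar>c k x * (g x \<bullet> g x)\<bar> \<le> \<bar>norm (g x)\<bar> * \<bar>(C' * m) * norm (g x)\<bar>" if "x \<in> space M" for x
      using mult_right_mono[OF c(2)[of x k], of "norm (g x) * norm (g x)"] c(1)[of x k] that m C'(1)
      by (simp add: power2_norm_eq_inner[symmetric] power2_eq_square abs_mult mult_ac)
  qed auto
  have intR: "integrable M (?R k)" for k
    using Bochner_Integration.integrable_diff[OF intcw[of k] intcg[of k]]
    by (simp add: inner_diff_right algebra_simps)
  \<comment> \<open>\<open>?P k + ?R k\<close> is \<open>g \<bullet> gradient (v k)\<close> without the nonnegative term \<open>c k x * (g x \<bullet> g x)\<close>;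
    this avoids any pointwise convergence of \<open>gradient (w k)\<close>.\<close>
  have ineq: "(LINT x|M. ?P k x) + (LINT x|M. ?R k x) \<le> l * (LINT x|M. u x * v k x)" for k
  proof -
    have "(LINT x|M. ?P k x) + (LINT x|M. ?R k x) = (LINT x|M. ?P k x + ?R k x)"
      using intP intR by simp
    also have "\<dots> \<le> (LINT x|M. g x \<bullet> gradient (v k) x)"
    proof (rule integral_mono)
      show "integrable M (\<lambda>x. ?P k x + ?R k x)" using intP intR by simp
      show "integrable M (\<lambda>x. g x \<bullet> gradient (v k) x)"
        unfolding dv inner_add_right using intP intcw by (intro Bochner_Integration.integrable_add)
      show "?P k x + ?R k x \<le> g x \<bullet> gradient (v k) x" if "x \<in> space M" for x
        using c(1)[of x k] that unfolding dv
        by (simp add: inner_add_right inner_diff_right algebra_simps)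
    qed
    also have "\<dots> = l * (LINT x|M. u x * v k x)"
      by (rule weak_eq[OF v_test])
    finally show ?thesis .
  qed
  have wu: "\<bar>tanh (m * w k x) - tanh (m * u x)\<bar> \<le> m * \<bar>w k x - u x\<bar>" for k x
    using tanh_lipschitz[of "m * w k x" "m * u x"] m
    by (simp add: right_diff_distrib[symmetric] abs_mult)
  have limP: "(\<lambda>k. LINT x|M. ?P k x) \<longlonglongrightarrow> (LINT x|M. g x \<bullet> (tanh (m * u x) *\<^sub>R gradient \<psi> x))"
  proof (rule tendsto_integral_L2[OF intP intP' _ _ _ w_lim, where b = "\<lambda>x. (m * C) * norm (g x)"])
    show "(\<integral>\<^sup>+ x. ennreal (((m * C) * norm (g x))\<^sup>2) \<partial>M) < \<infinity>"
      using g_L2 by (simp add: power_mult_distrib ennreal_mult nn_integral_cmult ennreal_mult_less_top)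
    show "\<bar>?P k x - g x \<bullet> (tanh (m * u x) *\<^sub>R gradient \<psi> x)\<bar> \<le> \<bar>w k x - u x\<bar> * \<bar>(m * C) * norm (g x)\<bar>"
      if "x \<in> space M" for k x
    proof -
      have "\<bar>?P k x - g x \<bullet> (tanh (m * u x) *\<^sub>R gradient \<psi> x)\<bar> =
          \<bar>tanh (m * w k x) - tanh (m * u x)\<bar> * \<bar>g x \<bullet> gradient \<psi> x\<bar>"
        by (simp add: left_diff_distrib[symmetric] abs_mult)
      also have "\<dots> \<le> (m * \<bar>w k x - u x\<bar>) * (norm (g x) * C)"
        using that C m
        by (intro mult_mono wu order_trans[OF Cauchy_Schwarz_ineq2] mult_left_mono) auto
      finally show ?thesis using m C(1) by (simp add: abs_mult mult_ac)
    qed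
  qed auto
  have limV: "(\<lambda>k. LINT x|M. u x * v k x) \<longlonglongrightarrow> (LINT x|M. u x * (\<psi> x * tanh (m * u x)))"
  proof (rule tendsto_integral_L2[OF intV intV' _ _ _ w_lim, where b = "\<lambda>x. (m * C') * u x"])
    show "(\<integral>\<^sup>+ x. ennreal (((m * C') * u x)\<^sup>2) \<partial>M) < \<infinity>"
      using u_L2 by (simp add: power_mult_distrib ennreal_mult nn_integral_cmult ennreal_mult_less_top)
    show "\<bar>u x * v k x - u x * (\<psi> x * tanh (m * u x))\<bar> \<le> \<bar>w k x - u x\<bar> * \<bar>(m * C') * u x\<bar>"
      if "x \<in> space M" for k x
    proof -
      have "\<bar>u x * v k x - u x * (\<psi> x * tanh (m * u x))\<bar> =
          \<bar>tanh (m * w k x) - tanh (m * u x)\<bar> * (\<bar>u x\<bar> * \<bar>\<psi> x\<bar>)"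
        by (simp add: v_def right_diff_distrib[symmetric] abs_mult)
      also have "\<dots> \<le> (m * \<bar>w k x - u x\<bar>) * (\<bar>u x\<bar> * C')"
        using that C' m by (intro mult_mono wu mult_left_mono) auto
      finally show ?thesis using m C'(1) by (simp add: abs_mult mult_ac)
    qed
  qed auto
  have limR: "(\<lambda>k. LINT x|M. ?R k x) \<longlonglongrightarrow> (LINT x|M. 0)"
  proof (rule tendsto_integral_L2[OF intR _ _ _ _ w_grad_lim, where b = "\<lambda>x. (C' * m) * norm (g x)"])
    show "(\<integral>\<^sup>+ x. ennreal (((C' * m) * norm (g x))\<^sup>2) \<partial>M) < \<infinity>"
      using g_L2 by (simp add: power_mult_distrib ennreal_mult nn_integral_cmult ennreal_mult_less_top)
    show "\<bar>?R k x - 0\<bar> \<le> \<bar>norm (gradient (w k) x - g x)\<bar> * \<bar>(C' * m) * norm (g x)\<bar>"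
      if "x \<in> space M" for k x
    proof -
      have "\<bar>?R k x - 0\<bar> = c k x * \<bar>g x \<bullet> (gradient (w k) x - g x)\<bar>"
        using c[of x k] that by (simp add: abs_mult)
      also have "\<dots> \<le> (C' * m) * (norm (g x) * norm (gradient (w k) x - g x))"
        using c[of x k] that m C' by (intro mult_mono Cauchy_Schwarz_ineq2) auto
      finally show ?thesis using m C'(1) by (simp add: abs_mult mult_ac)
    qed
  qed auto
  show ?thesis
    using LIMSEQ_le[OF tendsto_add[OF limP limR] tendsto_mult_left[OF limV, of l]] ineq by auto
qed

text \<open>Positivity of \<open>u\<close> makes \<open>tanh (m * u x)\<close> tend to 1 at every
  point of \<Omega>, and the integrands without this factor dominate. What the cut-off would
  contribute at the boundary has been discarded with a sign, hence an inequality and not an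
  equation.\<close>

lemma subsolution:
  assumes psi: "smooth_fun \<psi>" and nonneg: "\<And>x. x \<in> \<Omega> \<Longrightarrow> \<psi> x \<ge> 0"
  shows "0 \<le> (LINT x|M. u x * laplacian \<psi> x) + l * (LINT x|M. u x * \<psi> x)"
proof -
  note cP = smooth_fun_continuous_on[OF psi] and cG = continuous_on_gradient[OF psi]
  note [measurable] = borel_measurable_M[OF cP] borel_measurable_M[OF cG]
  have [measurable]: "(tanh :: real \<Rightarrow> real) \<in> borel_measurable borel"
    by (intro borel_measurable_continuous_onI continuous_on_tanh continuous_on_id) auto
  have tanh1: "\<bar>tanh s\<bar> \<le> 1" for s :: real
    using tanh_real_bounds[of s] by (auto simp: abs_le_iff)
  obtain C where C: "C > 0" "\<And>x. x \<in> \<Omega> \<Longrightarrow> norm (gradient \<psi> x) \<le> C"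
    using bounded_on_domain[OF cG] by metis
  obtain C' where C': "C' > 0" "\<And>x. x \<in> \<Omega> \<Longrightarrow> norm (\<psi> x) \<le> C'"
    using bounded_on_domain[OF cP] by metis
  have t: "(\<lambda>n. tanh (real (Suc n) * u x)) \<longlonglongrightarrow> 1" if "x \<in> \<Omega>" for x
  proof (rule filterlim_compose[OF tanh_real_at_top])
    show "filterlim (\<lambda>n. real (Suc n) * u x) at_top sequentially"
      using pos[OF that] filterlim_compose[OF filterlim_real_sequentially filterlim_Suc]
      by (intro filterlim_at_top_mult_tendsto_pos[OF tendsto_const]) auto
  qed
  have "(\<lambda>n. LINT x|M. g x \<bullet> (tanh (real (Suc n) * u x) *\<^sub>R gradient \<psi> x)) \<longlonglongrightarrow> (LINT x|M. g x \<bullet> gradient \<psi> x)"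
  proof (rule integral_dominated_convergence[where w = "\<lambda>x. \<bar>g x \<bullet> gradient \<psi> x\<bar>"])
    show "integrable M (\<lambda>x. \<bar>g x \<bullet> gradient \<psi> x\<bar>)"
      using C by (intro integrable_abs integrable_g_inner[of _ C]) auto
    show "AE x in M. (\<lambda>n. g x \<bullet> (tanh (real (Suc n) * u x) *\<^sub>R gradient \<psi> x)) \<longlonglongrightarrow> g x \<bullet> gradient \<psi> x"
    proof (intro AE_I2)
      fix x assume "x \<in> space M"
      then show "(\<lambda>n. g x \<bullet> (tanh (real (Suc n) * u x) *\<^sub>R gradient \<psi> x)) \<longlonglongrightarrow> g x \<bullet> gradient \<psi> x"
        using tendsto_mult_right[OF t, of x "g x \<bullet> gradient \<psi> x"] by simp
    qed
    show "AE x in M. norm (g x \<bullet> (tanh (real (Suc n) * u x) *\<^sub>R gradient \<psi> x)) \<le> \<bar>g x \<bullet> gradient \<psi> x\<bar>" for n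
      by (intro AE_I2) (simp add: abs_mult mult_left_le_one_le tanh1 del: of_nat_Suc)
  qed measurable
  moreover have "(\<lambda>n. LINT x|M. u x * (\<psi> x * tanh (real (Suc n) * u x))) \<longlonglongrightarrow> (LINT x|M. u x * \<psi> x)"
  proof (rule integral_dominated_convergence[where w = "\<lambda>x. \<bar>u x * \<psi> x\<bar>"])
    show "integrable M (\<lambda>x. \<bar>u x * \<psi> x\<bar>)"
      using C' by (intro integrable_abs integrable_u_mult[of _ C']) auto
    show "AE x in M. (\<lambda>n. u x * (\<psi> x * tanh (real (Suc n) * u x))) \<longlonglongrightarrow> u x * \<psi> x"
    proof (intro AE_I2)
      fix x assume "x \<in> space M"
      then show "(\<lambda>n. u x * (\<psi> x * tanh (real (Suc n) * u x))) \<longlonglongrightarrow> u x * \<psi> x"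
        using tendsto_mult_left[OF t, of x "u x * \<psi> x"] by (simp add: mult.assoc)
    qed
    show "AE x in M. norm (u x * (\<psi> x * tanh (real (Suc n) * u x))) \<le> \<bar>u x * \<psi> x\<bar>" for n
      by (intro AE_I2) (simp add: abs_mult mult_left_le tanh1 mult_left_mono del: of_nat_Suc)
  qed measurable
  ultimately have "(LINT x|M. g x \<bullet> gradient \<psi> x) \<le> l * (LINT x|M. u x * \<psi> x)"
    using subsolution_tanh[OF psi nonneg, of "real (Suc n)" for n]
    by (intro LIMSEQ_le[OF _ tendsto_mult_left]) auto
  then show ?thesis
    using integral_g_gradient[OF psi] by simp
qed

end

subsection \<open>Comparison with the heat evolution\<close>

text \<open>The value is (4 pi)^(n/2), but it is kept abstract: it serves as a normalization, for
  which positivity is enough.\<close>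

definition gaussian_mass :: "'a::euclidean_space itself \<Rightarrow> real" where
  "gaussian_mass _ = (LINT z|lborel. exp (- (norm (z::'a))\<^sup>2 / 4))"

text \<open>The unnormalized heat kernel at time $r^2$.\<close>

definition heat_weight :: "real \<Rightarrow> 'a::euclidean_space \<Rightarrow> 'a \<Rightarrow> real" where
  "heat_weight r y x = exp (- (norm (x - y))\<^sup>2 / (4 * r\<^sup>2))"

lemma heat_weight_eq: "heat_weight r y = (\<lambda>x. exp (0 + - 1 / (4 * r\<^sup>2) * (norm (x - y))\<^sup>2))"
  by (simp add: heat_weight_def fun_eq_iff)

lemma smooth_fun_heat_weight: "smooth_fun (heat_weight r y)"
  using smooth_fun_norm_diff_power2[of 0 "- 1 / (4 * r\<^sup>2)" y] diffk_exp
  unfolding heat_weight_eq smooth_fun_iff_diffk by blast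

lemma continuous_on_heat_weight: "continuous_on A (heat_weight r y)"
  by (rule smooth_fun_continuous_on[OF smooth_fun_heat_weight])

lemma borel_measurable_heat_weight [measurable]: "heat_weight r y \<in> borel_measurable borel"
  by (rule borel_measurable_continuous_onI[OF continuous_on_heat_weight])

lemma heat_weight_bounds: "0 < heat_weight r y x" "heat_weight r y x \<le> 1"
  by (auto simp: heat_weight_def)

lemma laplacian_heat_weight:
  fixes y :: "'a::euclidean_space"
  assumes "r \<noteq> 0"
  shows "laplacian (heat_weight r y) x =
    ((norm (x - y))\<^sup>2 / (4 * r ^ 4) - real DIM('a) / (2 * r\<^sup>2)) * heat_weight r y x"
proof -
  define a where "a = - 1 / (4 * r\<^sup>2)"
  let ?h = "heat_weight r y"
  have der: "(?h has_derivative (\<lambda>h. ?h x * ((2 * a) *\<^sub>R (x - y) \<bullet> h))) (at x)" for x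
    unfolding heat_weight_eq a_def[symmetric]
    by (rule has_derivative_eq_rhs[OF has_derivative_exp[OF norm_diff_power2_has_derivative]])
      (simp add: mult.commute)
  have d1: "frechet_derivative ?h (at x) b = ?h x * (2 * a * ((x - y) \<bullet> b))" for x b
    using frechet_derivative_at[OF der[of x]] by (simp add: fun_eq_iff)
  have d2: "frechet_derivative (\<lambda>z. frechet_derivative ?h (at z) b) (at x) b =
      4 * a\<^sup>2 * ((x - y) \<bullet> b)\<^sup>2 * ?h x + 2 * a * ?h x" if "b \<in> Basis" for b
  proof -
    have "((\<lambda>z. ?h z * (2 * a * ((z - y) \<bullet> b))) has_derivative
      (\<lambda>h. ?h x * (2 * a * (h \<bullet> b)) + (?h x * ((2 * a) *\<^sub>R (x - y) \<bullet> h)) * (2 * a * ((x - y) \<bullet> b)))) (at x)"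
      by (rule has_derivative_mult[OF der]) (auto intro!: derivative_eq_intros)
    then have "((\<lambda>z. frechet_derivative ?h (at z) b) has_derivative
      (\<lambda>h. ?h x * (2 * a * (h \<bullet> b)) + (?h x * ((2 * a) *\<^sub>R (x - y) \<bullet> h)) * (2 * a * ((x - y) \<bullet> b)))) (at x)"
      by (simp only: d1)
    from frechet_derivative_at[OF this, symmetric] show ?thesis
      using that by (simp add: power2_eq_square algebra_simps)
  qed
  have "laplacian ?h x = (\<Sum>b\<in>Basis. 4 * a\<^sup>2 * ((x - y) \<bullet> b)\<^sup>2 * ?h x + 2 * a * ?h x)"
    unfolding laplacian_def by (rule sum.cong[OF refl d2])
  also have "\<dots> = 4 * a\<^sup>2 * (\<Sum>b\<in>Basis. ((x - y) \<bullet> b)\<^sup>2) * ?h x + real DIM('a) * (2 * a * ?h x)"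
    by (simp add: sum.distrib sum_distrib_left sum_distrib_right mult_ac)
  also have "(\<Sum>b\<in>Basis. ((x - y) \<bullet> b)\<^sup>2) = (norm (x - y))\<^sup>2"
    unfolding power2_norm_eq_inner by (subst (2) euclidean_inner) (simp add: power2_eq_square)
  finally show ?thesis
    using assms by (simp add: a_def power2_eq_square power4_eq_xxxx field_simps)
qed

lemma heat_weight_scale: "r \<noteq> 0 \<Longrightarrow> heat_weight r y (y + r *\<^sub>R z) = exp (- (norm z)\<^sup>2 / 4)"
  by (simp add: heat_weight_def power_mult_distrib)

lemma integrable_heat_weight:
  fixes y :: "'a::euclidean_space"
  assumes "r > 0"
  shows "integrable lborel (heat_weight r y)"
    and "(LINT x|lborel. heat_weight r y x) = r ^ DIM('a) * gaussian_mass TYPE('a)"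
proof -
  note m = borel_measurable_heat_weight[of r y]
  show "integrable lborel (heat_weight r y)"
    using integrable_lborel_affine_iff[OF m, of r y] integrable_gaussian[where 'a = 'a] assms
    by (simp add: heat_weight_scale)
  show "(LINT x|lborel. heat_weight r y x) = r ^ DIM('a) * gaussian_mass TYPE('a)"
    using integral_lborel_affine[OF m, of r y] assms
    by (simp add: heat_weight_scale gaussian_mass_def)
qed

lemma gaussian_mass_pos: "gaussian_mass TYPE('a::euclidean_space) > 0"
proof -
  have "gaussian_mass TYPE('a) \<noteq> 0"
  proof
    assume "gaussian_mass TYPE('a) = 0"
    then have "AE z in (lborel :: 'a measure). exp (- (norm z)\<^sup>2 / 4) = 0"
      unfolding gaussian_mass_def
      by (subst (asm) integral_nonneg_eq_0_iff_AE[OF integrable_gaussian]) auto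
    then have "AE z in (lborel :: 'a measure). False" by simp
    then show False
      by (simp add: AE_iff_null null_sets_def)
  qed
  moreover have "gaussian_mass TYPE('a) \<ge> 0"
    unfolding gaussian_mass_def by (intro integral_nonneg_AE) auto
  ultimately show ?thesis by simp
qed

context positive_dirichlet_solution
begin

lemma integral_M_eq_lborel:
  fixes f :: "'a \<Rightarrow> real"
  assumes "f \<in> borel_measurable borel"
  shows "(LINT x|M. f x) = (LINT x|lborel. indicator \<Omega> x * f x)"
proof -
  have "(LINT x|M. f x) = (LINT x|lebesgue. indicator \<Omega> x *\<^sub>R f x)"
    using domain_sets by (intro integral_restrict_space) auto
  also have "\<dots> = (LINT x|lborel. indicator \<Omega> x *\<^sub>R f x)"
    using assms open_domain by (intro integral_completion) simp
  finally show ?thesis by simp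
qed

text \<open>Up to the factor \<open>gaussian_mass\<close>, this is exp(l t) times the heat evolution
  at \<open>y\<close> of the zero extension of \<open>u\<close>, at time t = r^2. The parameter
  \<open>r\<close> is the length scale, so rescaling by \<open>r\<close> leads to the standard
  Gaussian.\<close>

definition heat_average :: "'a \<Rightarrow> real \<Rightarrow> real" where
  "heat_average y r = exp (l * r\<^sup>2) * inverse r ^ DIM('a) * (LINT x|M. u x * heat_weight r y x)"

lemma integrable_u_heat_weight: "integrable M (\<lambda>x. u x * heat_weight r y x)"
  using heat_weight_bounds[of r y] borel_measurable_M[OF continuous_on_heat_weight]
  by (intro integrable_u_mult[of _ 1]) (auto simp: abs_of_pos)

lemma integrable_u: "integrable M u"
  using integrable_u_mult[of "\<lambda>_. 1" 1] by simp

text \<open>The normalized kernel solves the heat equation in t = r^2, so the derivative becomes a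
  Laplacian on the kernel, and the subsolution inequality tested with the heat weight fixes the
  sign. The factor 2r comes from the chain rule.\<close>

lemma heat_average_has_derivative_nonneg:
  assumes r: "r > 0"
  shows "\<exists>d\<ge>0. (heat_average y has_real_derivative d) (at r)"
proof -
  let ?N = "real DIM('a)"
  let ?q = "\<lambda>x. (norm (x - y))\<^sup>2"
  define I where "I = (LINT x|M. u x * heat_weight r y x)"
  define J where "J = (LINT x|M. u x * (?q x * heat_weight r y x))"
  have cq: "continuous_on UNIV ?q" by (intro continuous_intros)
  obtain C where C: "C > 0" "\<And>x. x \<in> \<Omega> \<Longrightarrow> norm (?q x) \<le> C"
    using bounded_on_domain[OF cq] by metis
  note [measurable] = borel_measurable_M[OF cq] borel_measurable_M[OF continuous_on_heat_weight]
  have qC: "\<bar>?q x * heat_weight s y x\<bar> \<le> C" if "x \<in> \<Omega>" for x s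
    using mult_mono[OF C(2)[OF that] heat_weight_bounds(2)[of s y x]] C(1) heat_weight_bounds(1)[of s y x]
    by simp
  have intJ: "integrable M (\<lambda>x. u x * (?q x * heat_weight s y x))" for s
    using qC by (intro integrable_u_mult[of _ C]) auto
  have "((\<lambda>s. LINT x|M. u x * heat_weight s y x) has_real_derivative
      (LINT x|M. u x * (?q x * heat_weight r y x) / (2 * r ^ 3))) (at r)"
  \<comment> \<open>Within distance r/2 of \<open>r\<close> the parameter stays above r/2, which
    bounds the factor 1/s^3 by a constant.\<close>
  proof (rule has_real_derivative_integral[where e = "r / 2" and
        B = "\<lambda>x. \<bar>u x\<bar> * (C / (2 * (r / 2) ^ 3))"])
    fix s assume s: "s \<in> ball r (r / 2)"
    then have s': "s > r / 2" "s > 0"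
      using r by (auto simp: dist_real_def abs_if split: if_splits)
    fix x assume x: "x \<in> space M"
    show "((\<lambda>s. u x * heat_weight s y x) has_real_derivative u x * (?q x * heat_weight s y x) / (2 * s ^ 3)) (at s)"
      unfolding heat_weight_def using s'
      by (auto intro!: derivative_eq_intros simp: power2_eq_square power3_eq_cube field_simps)
    have "\<bar>u x * (?q x * heat_weight s y x) / (2 * s ^ 3)\<bar> = (\<bar>u x\<bar> * \<bar>?q x * heat_weight s y x\<bar>) / (2 * s ^ 3)"
      using s' by (simp add: abs_mult)
    also have "\<dots> \<le> (\<bar>u x\<bar> * C) / (2 * (r / 2) ^ 3)"
      using s' r x C(1) by (intro frac_le mult_left_mono qC power_mono) auto
    finally show "\<bar>u x * (?q x * heat_weight s y x) / (2 * s ^ 3)\<bar> \<le> \<bar>u x\<bar> * (C / (2 * (r / 2) ^ 3))"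
      by simp
  qed (use r integrable_u_heat_weight integrable_u in auto)
  then have dI: "((\<lambda>s. LINT x|M. u x * heat_weight s y x) has_real_derivative J / (2 * r ^ 3)) (at r)"
    by (simp add: J_def)
  \<comment> \<open>In this factored form the bracket is the integral of \<open>u\<close> against
    the Laplacian of the heat weight plus \<open>l\<close> times the weight.\<close>
  define d where "d = exp (l * r\<^sup>2) * inverse r ^ DIM('a) * (2 * r) *
    (J / (4 * r ^ 4) - ?N * I / (2 * r\<^sup>2) + l * I)"
  have "inverse r ^ (DIM('a) - 1) * (inverse r)\<^sup>2 = inverse r ^ DIM('a) * inverse r"
    using DIM_positive[where 'a = 'a] by (cases "DIM('a)") (auto simp: power2_eq_square)
  then have "((\<lambda>s. inverse s ^ DIM('a)) has_real_derivative - (?N * (inverse r ^ DIM('a) * inverse r))) (at r)"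
    using r by (auto intro!: derivative_eq_intros simp: numeral_2_eq_2 mult_ac)
  moreover have "((\<lambda>s. exp (l * s\<^sup>2)) has_real_derivative exp (l * r\<^sup>2) * (2 * l * r)) (at r)"
    by (auto intro!: derivative_eq_intros)
  ultimately have "(heat_average y has_real_derivative
     (exp (l * r\<^sup>2) * (2 * l * r) * inverse r ^ DIM('a) +
      - (?N * (inverse r ^ DIM('a) * inverse r)) * exp (l * r\<^sup>2)) * I +
     J / (2 * r ^ 3) * (exp (l * r\<^sup>2) * inverse r ^ DIM('a))) (at r)"
    unfolding heat_average_def[abs_def] I_def by (intro DERIV_mult dI)
  also have "(exp (l * r\<^sup>2) * (2 * l * r) * inverse r ^ DIM('a) +
      - (?N * (inverse r ^ DIM('a) * inverse r)) * exp (l * r\<^sup>2)) * I +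
     J / (2 * r ^ 3) * (exp (l * r\<^sup>2) * inverse r ^ DIM('a)) =
     exp (l * r\<^sup>2) * inverse r ^ DIM('a) * (2 * l * r * I - ?N * inverse r * I + J / (2 * r ^ 3))"
    by (simp add: algebra_simps)
  also have "2 * l * r * I - ?N * inverse r * I + J / (2 * r ^ 3) =
      (2 * r) * (J / (4 * r ^ 4) - ?N * I / (2 * r\<^sup>2) + l * I)"
    using r by (simp add: field_simps power2_eq_square power3_eq_cube power4_eq_xxxx)
  finally have "(heat_average y has_real_derivative d) (at r)"
    by (simp add: d_def mult.assoc)
  moreover have "d \<ge> 0"
  proof -
    have "(LINT x|M. u x * laplacian (heat_weight r y) x) =
        (LINT x|M. u x * (?q x * heat_weight r y x) * (1 / (4 * r ^ 4)) - u x * heat_weight r y x * (?N / (2 * r\<^sup>2)))"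
      using r by (intro Bochner_Integration.integral_cong refl) (simp add: laplacian_heat_weight algebra_simps)
    also have "\<dots> = J * (1 / (4 * r ^ 4)) - I * (?N / (2 * r\<^sup>2))"
      unfolding I_def J_def using intJ integrable_u_heat_weight
      by (subst Bochner_Integration.integral_diff) (intro integrable_mult_left, auto)
    finally have "0 \<le> J / (4 * r ^ 4) - ?N * I / (2 * r\<^sup>2) + l * I"
      using subsolution[OF smooth_fun_heat_weight, of r y] heat_weight_bounds(1)[of r y]
      by (simp add: I_def less_imp_le mult.commute)
    then show ?thesis
      unfolding d_def using r by (intro mult_nonneg_nonneg) auto
  qed
  ultimately show ?thesis by blast
qed

lemma heat_average_mono:
  assumes "0 < s" "s \<le> r"
  shows "heat_average y s \<le> heat_average y r"
  by (rule DERIV_nonneg_imp_nondecreasing[OF assms(2)])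
    (metis assms(1) heat_average_has_derivative_nonneg less_le_trans)

text \<open>By monotonicity the value at \<open>r\<close> dominates those at arbitrarily small
  scales, which concentrate at \<open>y\<close>. A lower bound is enough: near \<open>y\<close>
  continuity keeps \<open>u\<close> above any level \<kappa> below \<open>u y\<close>, and farther
  out positivity lets the rest of the integral be dropped.\<close>

lemma le_heat_average:
  assumes y: "y \<in> \<Omega>" and r: "r > 0"
  shows "gaussian_mass TYPE('a) * u y \<le> heat_average y r"
proof -
  let ?c = "gaussian_mass TYPE('a)"
  have main: "\<kappa> * ?c \<le> heat_average y r" if k: "0 < \<kappa>" "\<kappa> < u y" for \<kappa>
  proof -
    have "open (\<Omega> \<inter> u -` {\<kappa><..})"
      using cont open_domain by (simp add: continuous_on_open_vimage Int_commute)
    then obtain \<delta> where d: "\<delta> > 0" "ball y \<delta> \<subseteq> \<Omega> \<inter> u -` {\<kappa><..}"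
      using y k open_contains_ball by (metis IntI greaterThan_iff vimageI)
    \<comment> \<open>Scales tending to 0 that stay below \<open>r\<close>, as monotonicity
      requires.\<close>
    define s where "s n = min r (1 / real (Suc n))" for n
    have s: "0 < s n" "s n \<le> r" "s n \<le> 1 / real (Suc n)" for n
      using r by (auto simp: s_def)
    have s0: "s \<longlonglongrightarrow> 0"
      using s by (intro tendsto_sandwich[OF _ _ tendsto_const LIMSEQ_inverse_real_of_nat])
        (auto simp: inverse_eq_divide less_imp_le intro!: always_eventually)
    let ?E = "\<lambda>z::'a. exp (- (norm z)\<^sup>2 / 4)"
    let ?G = "\<lambda>n. LINT z|lborel. indicator (ball 0 (\<delta> / s n)) z * ?E (z::'a)"
    have m: "(\<lambda>x. indicator (ball y \<delta>) x * heat_weight (s n) y x) \<in> borel_measurable borel" for n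
      by (intro borel_measurable_times borel_measurable_indicator borel_measurable_heat_weight) simp
    have lower: "exp (l * (s n)\<^sup>2) * (\<kappa> * ?G n) \<le> heat_average y r" for n
    proof -
      have "s n ^ DIM('a) * ?G n = (LINT x|lborel. indicator (ball y \<delta>) x * heat_weight (s n) y x)"
      proof -
        have "indicator (ball y \<delta>) (y + s n *\<^sub>R z) = (indicator (ball 0 (\<delta> / s n)) z :: real)" for z
          using s(1)[of n] by (simp add: indicator_def dist_norm field_simps)
        then show ?thesis
          using integral_lborel_affine[OF m, of "s n" n y] s(1)[of n] by (simp add: heat_weight_scale)
      qed
      also have "\<kappa> * \<dots> = (LINT x|M. \<kappa> * (indicator (ball y \<delta>) x * heat_weight (s n) y x))"
      proof -
        have "(LINT x|M. indicator (ball y \<delta>) x * heat_weight (s n) y x) =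
            (LINT x|lborel. indicator \<Omega> x * (indicator (ball y \<delta>) x * heat_weight (s n) y x))"
          by (rule integral_M_eq_lborel[OF m])
        also have "(\<lambda>x. indicator \<Omega> x * (indicator (ball y \<delta>) x * heat_weight (s n) y x)) =
            (\<lambda>x. indicator (ball y \<delta>) x * heat_weight (s n) y x)"
          using d(2) by (auto simp: indicator_def fun_eq_iff)
        finally show ?thesis by simp
      qed
      also have "\<dots> \<le> (LINT x|M. u x * heat_weight (s n) y x)"
      proof (rule integral_mono)
        show "integrable M (\<lambda>x. \<kappa> * (indicator (ball y \<delta>) x * heat_weight (s n) y x))"
        proof (intro integrable_mult_right integrable_const_bound[of _ 1])
          show "(\<lambda>x. indicator (ball y \<delta>) x * heat_weight (s n) y x) \<in> borel_measurable M"
            using m by (intro measurable_restrict_space1 measurable_completion) simp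
        qed (use heat_weight_bounds[of "s n" y] in \<open>auto simp: indicator_def abs_of_pos\<close>)
        show "\<kappa> * (indicator (ball y \<delta>) x * heat_weight (s n) y x) \<le> u x * heat_weight (s n) y x"
          if "x \<in> space M" for x
          using d(2) heat_weight_bounds(1)[of "s n" y x] pos[of x] that
          by (cases "x \<in> ball y \<delta>") (auto simp: subset_iff less_imp_le)
      qed (rule integrable_u_heat_weight)
      finally have "\<kappa> * ?G n \<le> inverse (s n) ^ DIM('a) * (LINT x|M. u x * heat_weight (s n) y x)"
        using s(1)[of n] by (simp add: power_inverse field_simps)
      then have "exp (l * (s n)\<^sup>2) * (\<kappa> * ?G n) \<le> heat_average y (s n)"
        unfolding heat_average_def by (simp add: mult.assoc)
      also have "\<dots> \<le> heat_average y r"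
        using s by (intro heat_average_mono)
      finally show ?thesis .
    qed
    \<comment> \<open>The rescaled balls of radius \<open>\<delta> / s n\<close> exhaust the space,
      so the truncated Gaussian integrals tend to the full mass.\<close>
    have "?G \<longlonglongrightarrow> (LINT z|lborel. ?E z)"
    proof (rule integral_dominated_convergence[OF _ _ integrable_gaussian])
      show "AE z in lborel. (\<lambda>n. indicator (ball 0 (\<delta> / s n)) z * ?E z) \<longlonglongrightarrow> ?E z"
      proof (intro AE_I2 tendsto_eventually)
        fix z :: 'a
        have "(\<lambda>n. s n * norm z) \<longlonglongrightarrow> 0 * norm z"
          by (intro tendsto_intros s0)
        then have "\<forall>\<^sub>F n in sequentially. s n * norm z < \<delta>"
          using d(1) by (intro order_tendstoD(2)) auto
        then show "\<forall>\<^sub>F n in sequentially. indicator (ball 0 (\<delta> / s n)) z * ?E z = ?E z"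
          by eventually_elim (use s(1) in \<open>simp add: indicator_def field_simps\<close>)
      qed
      show "AE z in lborel. norm (indicator (ball 0 (\<delta> / s n)) z * ?E z) \<le> ?E z" for n
        by (intro AE_I2) (simp add: indicator_def)
      show E: "?E \<in> borel_measurable lborel"
        by (rule borel_measurable_integrable[OF integrable_gaussian])
      show "(\<lambda>z. indicator (ball 0 (\<delta> / s n)) z * ?E z) \<in> borel_measurable lborel" for n
        by (intro borel_measurable_times borel_measurable_indicator E) simp
    qed
    then have "(\<lambda>n. exp (l * (s n)\<^sup>2) * (\<kappa> * ?G n)) \<longlonglongrightarrow> exp (l * 0\<^sup>2) * (\<kappa> * ?c)"
      unfolding gaussian_mass_def by (intro tendsto_intros s0)
    then have "exp (l * 0\<^sup>2) * (\<kappa> * ?c) \<le> heat_average y r"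
      by (rule LIMSEQ_le_const2) (use lower in blast)
    then show ?thesis by simp
  qed
  have "u y \<le> heat_average y r / ?c"
  proof (rule dense_le_bounded[OF pos[OF y]])
    fix \<kappa> assume "0 < \<kappa>" "\<kappa> < u y"
    then show "\<kappa> \<le> heat_average y r / ?c"
      using main gaussian_mass_pos[where 'a = 'a] by (simp add: field_simps)
  qed
  then show ?thesis
    using gaussian_mass_pos[where 'a = 'a] by (simp add: field_simps)
qed

lemma heat_average_le:
  assumes "r > 0"
  shows "heat_average y r \<le> exp (l * r\<^sup>2) * inverse r ^ DIM('a) * (LINT x|M. u x)"
  unfolding heat_average_def
proof (intro mult_left_mono integral_mono)
  show "u x * heat_weight r y x \<le> u x" if "x \<in> space M" for x
    using pos[of x] that heat_weight_bounds[of r y x] by (simp add: mult_left_le)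
qed (use assms integrable_u integrable_u_heat_weight in auto)

text \<open>For \<open>l \<le> 0\<close> the heat average is at most r^(-n) times the integral of
  \<open>u\<close>, which tends to 0 as \<open>r\<close> grows, although it dominates a fixed
  positive multiple of \<open>u y\<close>.\<close>

lemma eigenvalue_pos:
  assumes y: "y \<in> \<Omega>"
  shows "l > 0"
proof (rule ccontr)
  assume "\<not> l > 0"
  define K where "K = gaussian_mass TYPE('a) * u y"
  have K: "K > 0"
    unfolding K_def using gaussian_mass_pos pos[OF y] by (intro mult_pos_pos)
  define B where "B = (LINT x|M. u x)"
  have B: "B \<ge> 0"
    unfolding B_def using pos by (intro integral_nonneg_AE AE_I2) (auto intro: less_imp_le)
  have bound: "K * r \<le> B" if r: "r \<ge> 1" for r
  proof -
    have "K \<le> exp (l * r\<^sup>2) * inverse r ^ DIM('a) * B"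
      using le_heat_average[OF y, of r] heat_average_le[of r y] r unfolding K_def B_def by linarith
    also have "\<dots> \<le> 1 * inverse r * B"
      using \<open>\<not> l > 0\<close> r B power_decreasing[of 1 "DIM('a)" "inverse r"] DIM_positive[where 'a = 'a]
      by (intro mult_right_mono mult_mono) (auto simp: mult_nonpos_nonneg Suc_le_eq inverse_le_1_iff)
    finally show ?thesis using r by (simp add: field_simps)
  qed
  \<comment> \<open>The scale \<open>B / K + 1\<close> is at least 1 and makes the left side equal
    to \<open>B + K\<close>.\<close>
  have "K * (B / K + 1) \<le> B"
    using K B by (intro bound) simp
  then show False
    using K mult_pos_pos[OF K K] by (simp add: field_simps)
qed

text \<open>Heat smoothing turns integrability into boundedness. Only finiteness of the supremum
  matters, so time 1 will do.\<close>

lemma u_bounded: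
  obtains B where "\<And>y. y \<in> \<Omega> \<Longrightarrow> u y \<le> B"
proof
  show "u y \<le> exp l * (LINT x|M. u x) / gaussian_mass TYPE('a)" if "y \<in> \<Omega>" for y
    using le_heat_average[OF that, of 1] heat_average_le[of 1 y] gaussian_mass_pos[where 'a = 'a]
    by (simp add: field_simps)
qed

text \<open>Bounding \<open>u\<close> by \<open>S\<close> leaves the Gaussian mass of \<Omega>: the
  total less what the missing part of \<open>ball z d\<close> carries. At time d^2 the total mass
  and the volume of the ball both scale like d^n, so \<open>d\<close> survives only in the
  exponential.\<close>

lemma asymmetric_decay:
  assumes y: "y \<in> \<Omega>" and S: "\<And>x. x \<in> \<Omega> \<Longrightarrow> u x \<le> S"
    and d: "d > 0" "dist y z \<le> d"
    and asym: "\<alpha> * measure lebesgue (ball z d) \<le> measure lebesgue (ball z d - \<Omega>)"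
  shows "gaussian_mass TYPE('a) * u y \<le>
    exp (l * d\<^sup>2) * (S * (gaussian_mass TYPE('a) - \<alpha> * measure lebesgue (ball (0::'a) 1) * exp (-1)))"
proof -
  let ?h = "heat_weight d y"
  let ?D = "ball z d - \<Omega>"
  have [measurable]: "\<Omega> \<in> sets borel" using open_domain by simp
  have S0: "0 \<le> S" using S[OF y] pos[OF y] by simp
  have int: "integrable lborel (\<lambda>x. indicator A x * ?h x)" if [measurable]: "A \<in> sets borel" for A
    by (rule Bochner_Integration.integrable_bound[OF integrable_heat_weight(1)[OF d(1), of y]])
      (auto simp: indicator_def)
  have Dfin: "emeasure lborel ?D < \<infinity>"
    using emeasure_mono[of ?D "ball z d" lborel] emeasure_lborel_ball_finite[of z d]
    by (auto intro: le_less_trans)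
  have "(LINT x|M. u x * ?h x) \<le> (LINT x|M. S * ?h x)"
    using S heat_weight_bounds[of d y]
    by (intro integral_mono integrable_u_heat_weight integrable_mult_right integrable_const_bound[of _ 1])
      (auto simp: less_imp_le borel_measurable_M[OF continuous_on_heat_weight] intro!: mult_right_mono)
  also have "\<dots> = S * (LINT x|lborel. indicator \<Omega> x * ?h x)"
    using integral_M_eq_lborel[OF borel_measurable_heat_weight] by simp
  also have "\<dots> \<le> S * (d ^ DIM('a) * (gaussian_mass TYPE('a) - \<alpha> * measure lebesgue (ball (0::'a) 1) * exp (-1)))"
  proof (rule mult_left_mono[OF _ S0])
    have "exp (-1) * measure lborel ?D = (LINT x|lborel. exp (-1) * indicator ?D x)"
      using Dfin by simp
    also have "\<dots> \<le> (LINT x|lborel. indicator ?D x * ?h x)"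
    proof (rule integral_mono)
      show "integrable lborel (\<lambda>x. exp (-1) * indicator ?D x :: real)"
        using Dfin by (intro integrable_mult_right integrable_real_indicator) auto
      show "exp (-1) * indicator ?D x \<le> indicator ?D x * ?h x" for x
      proof (cases "x \<in> ?D")
        case True
        \<comment> \<open>\<open>x\<close> is within \<open>d\<close> of \<open>z\<close>, and
          \<open>z\<close> within \<open>d\<close> of \<open>y\<close>; at time d^2 the exponent is
          then at least -(2d)^2 / (4 d^2) = -1, the origin of exp(-1).\<close>
        then have "norm (x - y) \<le> 2 * d"
          using d dist_triangle[of x y z] by (simp add: dist_norm[symmetric] dist_commute)
        then have "(norm (x - y))\<^sup>2 \<le> (2 * d)\<^sup>2"
          by (intro power_mono) auto
        then have "(norm (x - y))\<^sup>2 / (4 * d\<^sup>2) \<le> 1"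
          using d by (simp add: power_mult_distrib)
        then show ?thesis using True by (simp add: heat_weight_def)
      qed simp
    qed (rule int, measurable)
    finally have 1: "exp (-1) * measure lborel ?D \<le> (LINT x|lborel. indicator ?D x * ?h x)" .
    have "(LINT x|lborel. indicator \<Omega> x * ?h x) + (LINT x|lborel. indicator ?D x * ?h x) =
        (LINT x|lborel. indicator \<Omega> x * ?h x + indicator ?D x * ?h x)"
      using int[of \<Omega>] int[of ?D] by simp
    also have "\<dots> \<le> (LINT x|lborel. ?h x)"
      using int[of \<Omega>] int[of ?D] heat_weight_bounds(1)[of d y]
      by (intro integral_mono integrable_heat_weight d) (auto simp: indicator_def less_imp_le)
    also have "\<dots> = d ^ DIM('a) * gaussian_mass TYPE('a)"
      by (rule integrable_heat_weight(2)[OF d(1)])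
    finally have 2: "(LINT x|lborel. indicator \<Omega> x * ?h x) + (LINT x|lborel. indicator ?D x * ?h x) \<le>
      d ^ DIM('a) * gaussian_mass TYPE('a)" .
    have 3: "exp (-1) * (\<alpha> * (d ^ DIM('a) * measure lebesgue (ball (0::'a) 1))) \<le> exp (-1) * measure lborel ?D"
      using asym content_ball_conv_unit_ball[of d z] d(1) by (intro mult_left_mono) auto
    have "d ^ DIM('a) * (gaussian_mass TYPE('a) - \<alpha> * measure lebesgue (ball (0::'a) 1) * exp (-1)) =
        d ^ DIM('a) * gaussian_mass TYPE('a) - exp (-1) * (\<alpha> * (d ^ DIM('a) * measure lebesgue (ball (0::'a) 1)))"
      by (simp add: algebra_simps)
    then show "(LINT x|lborel. indicator \<Omega> x * ?h x) \<le>
        d ^ DIM('a) * (gaussian_mass TYPE('a) - \<alpha> * measure lebesgue (ball (0::'a) 1) * exp (-1))"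
      using 1 2 3 by linarith
  qed
  finally have "inverse d ^ DIM('a) * (LINT x|M. u x * ?h x) \<le>
      S * (gaussian_mass TYPE('a) - \<alpha> * measure lebesgue (ball (0::'a) 1) * exp (-1))"
    using d(1) by (simp add: power_inverse field_simps)
  then have "heat_average y d \<le>
      exp (l * d\<^sup>2) * (S * (gaussian_mass TYPE('a) - \<alpha> * measure lebesgue (ball (0::'a) 1) * exp (-1)))"
    unfolding heat_average_def by (simp add: mult.assoc)
  then show ?thesis
    using le_heat_average[OF y d(1)] by linarith
qed

end

subsection \<open>Ground states of asymmetric domains\<close>

definition bump :: "'a::euclidean_space \<Rightarrow> real" where
  "bump x = flat_exp 0 (1 - (norm x)\<^sup>2)"

text \<open>Stands in for the first Dirichlet eigenvalue of the unit ball: an upper bound for it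
  that depends on the dimension alone.\<close>

definition bump_quotient :: "'a::euclidean_space itself \<Rightarrow> real" where
  "bump_quotient _ = (LINT x|lborel. (norm (gradient bump (x::'a)))\<^sup>2) / (LINT x|lborel. (bump (x::'a))\<^sup>2)"

lemma smooth_fun_bump_scaled: "smooth_fun (\<lambda>x. bump ((x - y) /\<^sub>R r))"
  using smooth_fun_flat_exp[OF smooth_fun_norm_diff_power2[of 1 "- ((inverse r)\<^sup>2)" y], of 0]
  by (simp add: bump_def power_mult_distrib power_inverse)

lemma smooth_fun_bump: "smooth_fun bump"
  using smooth_fun_bump_scaled[where y = 0 and r = 1] by simp

lemma gradient_bump_scaled:
  "gradient (\<lambda>x. bump ((x - y) /\<^sub>R r)) x = gradient bump ((x - y) /\<^sub>R r) /\<^sub>R r"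
proof (rule gradient_unique)
  have "((\<lambda>x. (x - y) /\<^sub>R r) has_derivative (\<lambda>h. h /\<^sub>R r)) (at x)"
    by (auto intro!: derivative_eq_intros)
  from has_derivative_compose[OF this smooth_fun_has_derivative_gradient[OF smooth_fun_bump]]
  show "((\<lambda>x. bump ((x - y) /\<^sub>R r)) has_derivative (\<lambda>h. (gradient bump ((x - y) /\<^sub>R r) /\<^sub>R r) \<bullet> h)) (at x)"
    by simp
qed

lemma bump_scaled_test_function:
  assumes r: "r > 0" and sub: "cball y r \<subseteq> U"
  shows "(\<lambda>x. bump ((x - y) /\<^sub>R r)) \<in> test_functions U"
proof -
  have "bump ((x - y) /\<^sub>R r) \<noteq> 0 \<longleftrightarrow> x \<in> ball y r" for x
  proof -
    have "norm ((x - y) /\<^sub>R r) = dist y x / r"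
      using r by (simp only: norm_scaleR) (simp add: dist_norm norm_minus_commute divide_inverse)
    then have "(norm ((x - y) /\<^sub>R r))\<^sup>2 < 1 \<longleftrightarrow> x \<in> ball y r"
      using r by (simp only: abs_square_less_1) simp
    then show ?thesis by (simp add: bump_def flat_exp_def)
  qed
  then have "{x. bump ((x - y) /\<^sub>R r) \<noteq> 0} = ball y r"
    by blast
  then have closure: "closure {x. bump ((x - y) /\<^sub>R r) \<noteq> 0} = cball y r"
    using r by (simp only: closure_ball)
  show ?thesis
    unfolding test_functions_def mem_Collect_eq closure using sub smooth_fun_bump_scaled by simp
qed

lemma integral_lebesgue_affine:
  fixes f :: "'a::euclidean_space \<Rightarrow> real"
  assumes "continuous_on UNIV f" "r > 0"
  shows "(LINT x|lebesgue. f x) = r ^ DIM('a) * (LINT x|lborel. f (y + r *\<^sub>R x))"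
  using assms integral_lborel_affine[of f r y] borel_measurable_continuous_onI[of f]
  by (simp add: integral_completion)

text \<open>Under the substitution x = y + r z both integrals gain r^n, and the gradient contributes
  the extra 1/r^2.\<close>

lemma rayleigh_lambda1_le_ball:
  fixes y :: "'a::euclidean_space"
  assumes r: "r > 0" and sub: "cball y r \<subseteq> interior U"
  shows "rayleigh_lambda1 U \<le> ereal (bump_quotient TYPE('a) / r\<^sup>2)"
proof -
  let ?u = "\<lambda>x. bump ((x - y) /\<^sub>R r)"
  have "?u y \<noteq> 0" by (simp add: bump_def flat_exp_def)
  then have "?u \<noteq> (\<lambda>x. 0)" by metis
  then have mem: "?u \<in> test_functions (interior U) - {\<lambda>x. 0}"
    using bump_scaled_test_function[OF r sub] by blast
  have "(LINT x|lebesgue. (?u x)\<^sup>2) = r ^ DIM('a) * (LINT x|lborel. (bump (x::'a))\<^sup>2)"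
    using r
    by (subst integral_lebesgue_affine[where y = y and r = r])
      (simp_all add: continuous_on_power smooth_fun_continuous_on smooth_fun_bump_scaled)
  moreover have "(LINT x|lebesgue. (norm (gradient ?u x))\<^sup>2) =
      r ^ DIM('a) * ((LINT x|lborel. (norm (gradient bump (x::'a)))\<^sup>2) / r\<^sup>2)"
    using r
    by (subst integral_lebesgue_affine[where y = y and r = r])
      (simp_all add: continuous_on_power continuous_on_norm continuous_on_gradient[OF smooth_fun_bump_scaled],
        simp add: gradient_bump_scaled power_mult_distrib power_inverse divide_inverse mult.commute)
  ultimately have "(LINT x|lebesgue. (norm (gradient ?u x))\<^sup>2) / (LINT x|lebesgue. (?u x)\<^sup>2) =
      bump_quotient TYPE('a) / r\<^sup>2"
    using r by (simp add: bump_quotient_def)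
  then show ?thesis
    unfolding rayleigh_lambda1_def by (intro INF_lower2[OF mem]) simp
qed

lemma bump_quotient_nonneg: "bump_quotient TYPE('a::euclidean_space) \<ge> 0"
  unfolding bump_quotient_def by (intro divide_nonneg_nonneg integral_nonneg_AE) auto

text \<open>This is \<kappa>: the missing part has at least \<alpha> times the volume of the ball
  and weight at least exp(-1), and this mass is taken relative to the total Gaussian mass.\<close>

definition decay_constant :: "real \<Rightarrow> 'a::euclidean_space itself \<Rightarrow> real" where
  "decay_constant \<alpha> _ = \<alpha> * measure lebesgue (ball (0::'a) 1) * exp (-1) / gaussian_mass TYPE('a)"

lemma decay_constant_pos:
  assumes "\<alpha> > 0" shows "decay_constant \<alpha> TYPE('a::euclidean_space) > 0"
  unfolding decay_constant_def using assms gaussian_mass_pos[where 'a = 'a] content_ball_pos[of 1 "0::'a"]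
  by (intro divide_pos_pos mult_pos_pos) auto

text \<open>A ball is connected, so if it met both \<Omega> and its complement it would contain a
  boundary point closer than the infimum.\<close>

lemma ball_infdist_frontier_subset:
  fixes y :: "'a::euclidean_space"
  assumes "y \<in> \<Omega>"
  shows "ball y (infdist y (frontier \<Omega>)) \<subseteq> \<Omega>"
proof (rule ccontr)
  let ?B = "ball y (infdist y (frontier \<Omega>))"
  assume "\<not> ?B \<subseteq> \<Omega>"
  then have ne: "?B - \<Omega> \<noteq> {}" by blast
  then obtain x where "x \<in> ?B" by blast
  then have "y \<in> ?B" using le_less_trans[OF zero_le_dist, of y x] by simp
  then have meet: "?B \<inter> \<Omega> \<noteq> {}" using assms by blast
  then obtain z where "z \<in> ?B" "z \<in> frontier \<Omega>"
    using connected_Int_frontier[OF connected_ball meet ne] by blast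
  then show False
    using infdist_le[of z "frontier \<Omega>" y] by simp
qed

section \<open>Maximum points stay away from the boundary\<close>

locale asymmetric_dirichlet_solution = positive_dirichlet_solution \<Omega> u g l
  for \<Omega> :: "'a::euclidean_space set" and u g l +
  fixes \<alpha> :: real
  assumes alpha: "\<alpha> > 0" and asymmetric: "asymmetric_domain \<alpha> \<Omega>"
begin

abbreviation "S \<equiv> SUP x\<in>\<Omega>. u x"

lemma nonempty: "\<Omega> \<noteq> {}"
  using asymmetric by (simp add: asymmetric_domain_def domain_set_def)

lemma frontier_nonempty: "frontier \<Omega> \<noteq> {}"
  using nonempty bounded_domain not_bounded_UNIV frontier_not_empty by metis

lemma le_S: "x \<in> \<Omega> \<Longrightarrow> u x \<le> S"
  using u_bounded by (metis bdd_aboveI2 cSUP_upper)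

lemma S_pos: "S > 0"
  using nonempty le_S pos by (meson ex_in_conv less_le_trans)

lemma infdist_frontier_pos: "y \<in> \<Omega> \<Longrightarrow> infdist y (frontier \<Omega>) > 0"
  using open_domain frontier_nonempty
  by (intro infdist_pos_not_in_closed) (auto simp: frontier_def interior_open)

lemma decay:
  assumes y: "y \<in> \<Omega>"
  shows "u y \<le> exp (l * (infdist y (frontier \<Omega>))\<^sup>2) * (S * (1 - decay_constant \<alpha> TYPE('a)))"
proof -
  let ?d = "infdist y (frontier \<Omega>)" and ?c = "gaussian_mass TYPE('a)"
  have d: "?d > 0" by (rule infdist_frontier_pos[OF y])
  obtain z where z: "z \<in> frontier \<Omega>" "?d = dist y z"
    using infdist_attains_inf[OF frontier_closed frontier_nonempty] by metis
  have "measure lebesgue (ball z ?d - \<Omega>) / measure lebesgue (ball z ?d) \<ge> \<alpha>"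
    using asymmetric z(1) d unfolding asymmetric_domain_def by blast
  then have "\<alpha> * measure lebesgue (ball z ?d) \<le> measure lebesgue (ball z ?d - \<Omega>)"
    using content_ball_pos[OF d, of z] by (simp add: field_simps)
  from asymmetric_decay[OF y le_S d eq_refl[OF z(2)[symmetric]] this]
  have "?c * u y \<le> exp (l * ?d\<^sup>2) * (S * (?c - \<alpha> * measure lebesgue (ball (0::'a) 1) * exp (-1)))"
    by simp
  also have "?c - \<alpha> * measure lebesgue (ball (0::'a) 1) * exp (-1) = ?c * (1 - decay_constant \<alpha> TYPE('a))"
    using gaussian_mass_pos[where 'a = 'a] by (simp add: decay_constant_def field_simps)
  finally have "?c * u y \<le> ?c * (exp (l * ?d\<^sup>2) * (S * (1 - decay_constant \<alpha> TYPE('a))))"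
    by (simp add: mult_ac)
  then show ?thesis
    using gaussian_mass_pos[where 'a = 'a] by simp
qed

text \<open>Continuity of \<open>u\<close> is known only inside \<Omega>. The decay estimate
  replaces boundary values: close to the boundary \<open>u\<close> stays below a fixed fraction of
  \<open>S\<close>, so the supremum is that over a compact set of points at distance at least
  \<delta>.\<close>

lemma max_attained: "\<exists>y\<in>\<Omega>. u y = S"
proof -
  have "((\<lambda>t. exp (l * t\<^sup>2) * (1 - decay_constant \<alpha> TYPE('a))) \<longlongrightarrow> exp (l * 0\<^sup>2) * (1 - decay_constant \<alpha> TYPE('a))) (at 0)"
    by (intro tendsto_intros)
  \<comment> \<open>Half of the decay constant is given up to absorb the exponential, which is close
    to 1 near the boundary.\<close>
  then have "\<forall>\<^sub>F t in at 0. exp (l * t\<^sup>2) * (1 - decay_constant \<alpha> TYPE('a)) < 1 - decay_constant \<alpha> TYPE('a) / 2"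
    using decay_constant_pos[OF alpha, where 'a = 'a] by (intro order_tendstoD(2)) auto
  then obtain \<delta> where delta: "\<delta> > 0"
    "\<And>t. t \<noteq> 0 \<Longrightarrow> \<bar>t\<bar> < \<delta> \<Longrightarrow> exp (l * t\<^sup>2) * (1 - decay_constant \<alpha> TYPE('a)) < 1 - decay_constant \<alpha> TYPE('a) / 2"
    by (auto simp: eventually_at dist_real_def)
  let ?\<theta> = "1 - decay_constant \<alpha> TYPE('a) / 2"
  have near: "u y \<le> S * ?\<theta>" if "y \<in> \<Omega>" "infdist y (frontier \<Omega>) < \<delta>" for y
  proof -
    have "u y \<le> S * (exp (l * (infdist y (frontier \<Omega>))\<^sup>2) * (1 - decay_constant \<alpha> TYPE('a)))"
      using decay[OF that(1)] by (simp add: mult_ac)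
    also have "\<dots> \<le> S * ?\<theta>"
      using delta(2)[of "infdist y (frontier \<Omega>)"] infdist_frontier_pos[OF that(1)] that(2) S_pos
      by (intro mult_left_mono) auto
    finally show ?thesis .
  qed
  have lt: "S * ?\<theta> < S"
    using S_pos decay_constant_pos[OF alpha, where 'a = 'a] by simp
  let ?K = "{y \<in> \<Omega>. infdist y (frontier \<Omega>) \<ge> \<delta>}"
  \<comment> \<open>Compactness of \<open>?K\<close>: a point of the closure at positive distance
    from the boundary lies in \<Omega>, so intersecting with the closure adds nothing.\<close>
  have "?K = closure \<Omega> \<inter> {y. infdist y (frontier \<Omega>) \<ge> \<delta>}"
  proof (intro equalityI subsetI)
    fix x assume x: "x \<in> closure \<Omega> \<inter> {y. infdist y (frontier \<Omega>) \<ge> \<delta>}"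
    then have "x \<notin> frontier \<Omega>" using delta(1) by auto
    then show "x \<in> ?K" using x open_domain by (simp add: frontier_def interior_open)
  qed (use closure_subset in auto)
  moreover have "closed {y. infdist y (frontier \<Omega>) \<ge> \<delta>}"
    by (intro closed_Collect_le continuous_intros)
  ultimately have K: "compact ?K"
    using bounded_domain by (simp add: compact_Int_closed)
  have "?K \<noteq> {}"
  proof
    assume "?K = {}"
    then have "S \<le> S * ?\<theta>"
      by (intro cSUP_least nonempty near) auto
    then show False using lt by simp
  qed
  moreover have "continuous_on ?K u"
    using cont by (rule continuous_on_subset) blast
  ultimately obtain y where y: "y \<in> ?K" "\<And>x. x \<in> ?K \<Longrightarrow> u x \<le> u y"
    using continuous_attains_sup[OF K] by blast
  have "u x \<le> max (S * ?\<theta>) (u y)" if "x \<in> \<Omega>" for x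
    using near[OF that] y(2)[of x] that by (cases "infdist x (frontier \<Omega>) < \<delta>") auto
  then have "S \<le> max (S * ?\<theta>) (u y)"
    by (intro cSUP_least nonempty)
  then have "u y = S"
    using lt le_S[of y] y(1) by auto
  then show ?thesis using y(1) by blast
qed

text \<open>Superlevel sets of \<open>u\<close> are open, hence not negligible unless empty. So the
  maximum points, defined by an essential supremum, are those where \<open>S\<close> is
  attained.\<close>

lemma esssup_eq_S: "esssup M (\<lambda>x. ereal \<bar>u x\<bar>) = ereal S"
proof (rule antisym)
  show "esssup M (\<lambda>x. ereal \<bar>u x\<bar>) \<le> ereal S"
    using le_S pos by (intro esssup_I AE_I2) (auto simp: abs_of_pos)
  show "ereal S \<le> esssup M (\<lambda>x. ereal \<bar>u x\<bar>)"
  proof (rule ccontr)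
    assume "\<not> ?thesis"
    then obtain t where t: "esssup M (\<lambda>x. ereal \<bar>u x\<bar>) < ereal t" "ereal t < ereal S"
      using ereal_dense2[of "esssup M (\<lambda>x. ereal \<bar>u x\<bar>)" "ereal S"] unfolding not_le by blast
    let ?V = "\<Omega> \<inter> u -` {t<..}"
    have V: "open ?V"
      using cont open_domain by (simp add: continuous_on_open_vimage Int_commute)
    have "AE x in M. ereal \<bar>u x\<bar> \<le> esssup M (\<lambda>x. ereal \<bar>u x\<bar>)"
      by (rule esssup_AE)
    then have "AE x in M. x \<notin> ?V"
      by eventually_elim (use t(1) in \<open>auto simp: not_less dest: le_less_trans\<close>)
    then have "AE x in lebesgue. x \<notin> ?V"
      using domain_sets by (subst (asm) AE_restrict_space_iff) (auto elim: eventually_mono)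
    then have "negligible ?V"
      using V by (simp add: negligible_iff_null_sets AE_iff_null_sets)
    then have "?V = {}"
      using open_not_negligible[OF V] by blast
    then show False
      using max_attained t(2) by auto
  qed
qed

lemma max_points_eq: "max_points \<Omega> u = {y\<in>\<Omega>. u y = S}"
  by (simp add: max_points_def esssup_eq_S)

text \<open>At a maximum point \<open>S\<close> cancels and the decay estimate reads exp(-l d^2)
  \<le> 1 - \<kappa>; then exp(-s) \<ge> 1 - s bounds l d^2 from below by \<kappa>.\<close>

lemma max_point_infdist:
  assumes "y \<in> max_points \<Omega> u"
  shows "sqrt (decay_constant \<alpha> TYPE('a)) \<le> sqrt l * infdist y (frontier \<Omega>)"
proof -
  let ?d = "infdist y (frontier \<Omega>)"
  have y: "y \<in> \<Omega>" "u y = S" using assms by (auto simp: max_points_eq)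
  have "S * 1 \<le> S * (exp (l * ?d\<^sup>2) * (1 - decay_constant \<alpha> TYPE('a)))"
    using decay[OF y(1)] y(2) by (simp add: mult_ac)
  then have "1 \<le> exp (l * ?d\<^sup>2) * (1 - decay_constant \<alpha> TYPE('a))"
    using S_pos by (simp only: mult_le_cancel_left_pos)
  then have "exp (- (l * ?d\<^sup>2)) \<le> 1 - decay_constant \<alpha> TYPE('a)"
    by (simp add: exp_minus field_simps)
  then have "decay_constant \<alpha> TYPE('a) \<le> l * ?d\<^sup>2"
    using exp_ge_add_one_self[of "- (l * ?d\<^sup>2)"] by linarith
  then have "sqrt (decay_constant \<alpha> TYPE('a)) \<le> sqrt (l * ?d\<^sup>2)" by simp
  also have "\<dots> = sqrt l * ?d"
    by (simp add: real_sqrt_mult abs_of_nonneg infdist_nonneg)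
  finally show ?thesis .
qed

lemma rayleigh_lambda1_obstacle:
  assumes D: "D \<noteq> {}" and \<rho>: "max_dist \<Omega> u D x > 0"
  shows "rayleigh_lambda1 (\<Omega> - translate x D) \<le>
    ereal (bump_quotient TYPE('a) / (min (max_dist \<Omega> u D x) (sqrt (decay_constant \<alpha> TYPE('a)) / sqrt l) / 2)\<^sup>2)"
proof -
  let ?T = "translate x D" and ?P = "max_points \<Omega> u" and ?\<rho> = "max_dist \<Omega> u D x"
  define q where "q = sqrt (decay_constant \<alpha> TYPE('a)) / sqrt l"
  \<comment> \<open>Halving serves twice: the definition of a supremum provides a maximum point
    farther than half of \<open>?\<rho>\<close> from the obstacle, and the closed ball fits strictly
    inside \<Omega>.\<close>
  define r where "r = min ?\<rho> q / 2"
  have l: "l > 0" using eigenvalue_pos nonempty by blast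
  have k: "decay_constant \<alpha> TYPE('a) > 0" by (rule decay_constant_pos[OF alpha])
  have P: "?P \<noteq> {}" "?P \<subseteq> \<Omega>" using max_attained by (auto simp: max_points_eq)
  obtain t where t: "t \<in> ?T" using D by (auto simp: translate_def)
  obtain B where B: "\<And>z. z \<in> \<Omega> \<Longrightarrow> dist t z \<le> B"
    using bounded_domain unfolding bounded_any_center[of _ t] by blast
  \<comment> \<open>A real supremum carries information only for a bounded family; distances to one
    fixed point \<open>t\<close> of the obstacle are bounded on \<Omega>.\<close>
  have "bdd_above ((\<lambda>y. infdist y ?T) ` ?P)"
    using B P(2) by (intro bdd_aboveI2[of _ _ B]) (metis dist_commute infdist_le2 subsetD t)
  then obtain y where y: "y \<in> ?P" "?\<rho> / 2 < infdist y ?T"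
    using less_cSUP_iff[OF P(1), of "\<lambda>y. infdist y ?T" "?\<rho> / 2"] \<rho>
    unfolding max_dist_def by auto
  have q: "q > 0" using k l by (simp add: q_def)
  have r: "r > 0" using \<rho> q by (simp add: r_def)
  have y\<Omega>: "y \<in> \<Omega>" using y P by blast
  have "q \<le> infdist y (frontier \<Omega>)"
    using max_point_infdist[OF y(1)] l by (simp add: q_def field_simps)
  moreover have "r \<le> q / 2" by (simp add: r_def)
  ultimately have r1: "r < infdist y (frontier \<Omega>)" using q by linarith
  have r2: "r < infdist y ?T" using y(2) by (simp add: r_def)
  \<comment> \<open>The difference of \<Omega> and the obstacle need not be open; an open ball
    inside it lies in its interior, where the test functions live.\<close>
  let ?B = "ball y (min (infdist y (frontier \<Omega>)) (infdist y ?T))"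
  have "?B \<subseteq> \<Omega> - ?T"
    using ball_infdist_frontier_subset[OF y\<Omega>] infdist_le[of _ ?T y] by force
  then have "?B \<subseteq> interior (\<Omega> - ?T)"
    by (intro interior_maximal) auto
  moreover have "cball y r \<subseteq> ?B"
    using r1 r2 by auto
  ultimately show ?thesis
    using rayleigh_lambda1_le_ball[OF r, of y] unfolding r_def q_def by blast
qed

end

section \<open>The function \<beta> and the choice of constants\<close>

lemma beta_fun_eq:
  assumes "r\<^sub>0 > 0" "l > 0" "\<rho> > 0" "\<beta>\<^sub>0 * r\<^sub>0\<^sup>2 = c\<^sub>0"
  shows "beta_fun c\<^sub>0 r\<^sub>0 \<beta>\<^sub>0 l \<rho> = c\<^sub>0 / (min (\<rho> * sqrt l) r\<^sub>0)\<^sup>2"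
  using assms by (auto simp: beta_fun_def min_def power_mult_distrib)

text \<open>The condition \<open>\<beta>\<^sub>0 * r\<^sub>0\<^sup>2 = c\<^sub>0\<close> makes the
  two branches agree at the threshold, so \<beta> is a single quotient by the square of a positive,
  continuous, nondecreasing minimum, and all three properties follow without cases.\<close>

lemma
  assumes "r\<^sub>0 > 0" "l > 0" "c\<^sub>0 > 0" "\<beta>\<^sub>0 * r\<^sub>0\<^sup>2 = c\<^sub>0"
  shows continuous_on_beta_fun: "continuous_on {0<..} (beta_fun c\<^sub>0 r\<^sub>0 \<beta>\<^sub>0 l)"
    and antimono_on_beta_fun: "antimono_on {0<..} (beta_fun c\<^sub>0 r\<^sub>0 \<beta>\<^sub>0 l)"
    and beta_fun_pos: "\<rho> > 0 \<Longrightarrow> beta_fun c\<^sub>0 r\<^sub>0 \<beta>\<^sub>0 l \<rho> > 0"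
proof -
  note eq = beta_fun_eq[OF assms(1,2) _ assms(4)]
  have pos: "min (\<rho> * sqrt l) r\<^sub>0 > 0" if "\<rho> > 0" for \<rho>
    using assms that by simp
  have "continuous_on {0<..} (\<lambda>\<rho>. c\<^sub>0 / (min (\<rho> * sqrt l) r\<^sub>0)\<^sup>2)"
    using pos by (intro continuous_intros) force
  then show "continuous_on {0<..} (beta_fun c\<^sub>0 r\<^sub>0 \<beta>\<^sub>0 l)"
    by (rule continuous_on_cong[THEN iffD1, rotated -1]) (auto simp: eq)
  show "antimono_on {0<..} (beta_fun c\<^sub>0 r\<^sub>0 \<beta>\<^sub>0 l)"
  proof (rule monotone_onI)
    fix a b :: real assume ab: "a \<in> {0<..}" "b \<in> {0<..}" "a \<le> b"
    have "c\<^sub>0 / (min (b * sqrt l) r\<^sub>0)\<^sup>2 \<le> c\<^sub>0 / (min (a * sqrt l) r\<^sub>0)\<^sup>2"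
      using ab assms pos[of a] pos[of b]
      by (intro divide_left_mono power_mono min.mono mult_right_mono mult_pos_pos zero_less_power) auto
    then show "beta_fun c\<^sub>0 r\<^sub>0 \<beta>\<^sub>0 l b \<le> beta_fun c\<^sub>0 r\<^sub>0 \<beta>\<^sub>0 l a"
      using ab by (simp add: eq)
  qed
  show "beta_fun c\<^sub>0 r\<^sub>0 \<beta>\<^sub>0 l \<rho> > 0" if "\<rho> > 0"
    unfolding eq[OF that] using pos[OF that] assms(3) by (intro divide_pos_pos zero_less_power)
qed

theorem theorem2p1:
  shows "\<exists>c\<^sub>0>0. \<forall>\<alpha>>0. \<exists>r\<^sub>0>0. \<exists>\<beta>\<^sub>0>0. \<beta>\<^sub>0 * r\<^sub>0\<^sup>2 = c\<^sub>0 \<and>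
    (\<forall>(\<Omega> :: (real ^ 'n) set) \<phi> D x.
       asymmetric_domain \<alpha> \<Omega> \<and> ground_state \<Omega> \<phi> \<and>
       domain_set D \<and> bounded D \<and> max_dist \<Omega> \<phi> D x > 0 \<longrightarrow>
       (let l = first_dirichlet_eigenvalue \<Omega>;
            \<beta> = beta_fun c\<^sub>0 r\<^sub>0 \<beta>\<^sub>0 l
        in continuous_on {0<..} \<beta> \<and> antimono_on {0<..} \<beta> \<and> (\<forall>\<rho>>0. \<beta> \<rho> > 0) \<and>
           rayleigh_lambda1 (\<Omega> - translate x D) \<le> ereal (\<beta> (max_dist \<Omega> \<phi> D x) * l)))"
proof -
  define Q where "Q = bump_quotient TYPE(real ^ 'n)"
  \<comment> \<open>The 4 compensates for the halved radius of the ball; the 1 ensures positivity,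
    \<open>Q\<close> being known only to be nonnegative.\<close>
  define c\<^sub>0 where "c\<^sub>0 = 4 * (Q + 1)"
  have Q: "Q \<ge> 0" unfolding Q_def by (rule bump_quotient_nonneg)
  then have c0: "c\<^sub>0 > 0" by (simp add: c\<^sub>0_def)
  show ?thesis
  proof (rule exI[of _ c\<^sub>0], intro conjI allI impI c0)
    fix \<alpha> :: real assume alpha: "\<alpha> > 0"
    \<comment> \<open>Maximum points have distance at least \<open>r\<^sub>0 / sqrt l\<close> from
      the boundary, so beyond this threshold the boundary, and no longer the obstacle, limits the
      ball.\<close>
    define r\<^sub>0 where "r\<^sub>0 = sqrt (decay_constant \<alpha> TYPE(real ^ 'n))"
    define \<beta>\<^sub>0 where "\<beta>\<^sub>0 = c\<^sub>0 / r\<^sub>0\<^sup>2"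
    have r0: "r\<^sub>0 > 0" using decay_constant_pos[OF alpha] by (simp add: r\<^sub>0_def)
    have b0: "\<beta>\<^sub>0 > 0" "\<beta>\<^sub>0 * r\<^sub>0\<^sup>2 = c\<^sub>0" using c0 r0 by (auto simp: \<beta>\<^sub>0_def)
    have main: "continuous_on {0<..} (beta_fun c\<^sub>0 r\<^sub>0 \<beta>\<^sub>0 l) \<and> antimono_on {0<..} (beta_fun c\<^sub>0 r\<^sub>0 \<beta>\<^sub>0 l) \<and>
        (\<forall>\<rho>>0. beta_fun c\<^sub>0 r\<^sub>0 \<beta>\<^sub>0 l \<rho> > 0) \<and>
        rayleigh_lambda1 (\<Omega> - translate x D) \<le> ereal (beta_fun c\<^sub>0 r\<^sub>0 \<beta>\<^sub>0 l (max_dist \<Omega> \<phi> D x) * l)"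
      if asym: "asymmetric_domain \<alpha> \<Omega>" and gs: "ground_state \<Omega> \<phi>" and D: "domain_set D"
        and rho: "max_dist \<Omega> \<phi> D x > 0" and l_def: "l = first_dirichlet_eigenvalue \<Omega>"
      for \<Omega> :: "(real ^ 'n) set" and \<phi> D x l
    proof -
      obtain g where g: "H10 \<Omega> \<phi> g" "\<forall>v\<in>test_functions \<Omega>.
           (LINT x|lebesgue_on \<Omega>. g x \<bullet> gradient v x) = l * (LINT x|lebesgue_on \<Omega>. \<phi> x * v x)"
        using gs unfolding ground_state_def dirichlet_eigenfunction_def l_def by blast
      interpret asymmetric_dirichlet_solution \<Omega> \<phi> g l \<alpha>
        using asym gs g alpha
        by unfold_locales (auto simp: asymmetric_domain_def domain_set_def ground_state_def)
      let ?\<rho> = "max_dist \<Omega> \<phi> D x"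
      have l: "l > 0" using eigenvalue_pos nonempty by blast
      have "rayleigh_lambda1 (\<Omega> - translate x D) \<le> ereal (Q / (min ?\<rho> (r\<^sub>0 / sqrt l) / 2)\<^sup>2)"
        using rayleigh_lambda1_obstacle[OF _ rho] D by (simp add: Q_def r\<^sub>0_def domain_set_def)
      also have "Q / (min ?\<rho> (r\<^sub>0 / sqrt l) / 2)\<^sup>2 \<le> (Q + 1) / (min ?\<rho> (r\<^sub>0 / sqrt l) / 2)\<^sup>2"
        by (intro divide_right_mono) auto
      also have "\<dots> = c\<^sub>0 / (min ?\<rho> (r\<^sub>0 / sqrt l))\<^sup>2"
        by (simp add: c\<^sub>0_def power_divide)
      \<comment> \<open>Measuring lengths in units of \<open>1 / sqrt l\<close> gives the form of
        \<open>beta_fun_eq\<close> and releases the factor \<open>l\<close>.\<close>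
      also have "min ?\<rho> (r\<^sub>0 / sqrt l) = min (?\<rho> * sqrt l) r\<^sub>0 / sqrt l"
        using l by (auto simp: min_def field_simps)
      also have "c\<^sub>0 / (min (?\<rho> * sqrt l) r\<^sub>0 / sqrt l)\<^sup>2 = beta_fun c\<^sub>0 r\<^sub>0 \<beta>\<^sub>0 l ?\<rho> * l"
        using l by (simp add: beta_fun_eq[OF r0 l rho b0(2)] power_divide)
      finally show ?thesis
        using continuous_on_beta_fun[OF r0 l c0 b0(2)] antimono_on_beta_fun[OF r0 l c0 b0(2)]
          beta_fun_pos[OF r0 l c0 b0(2)] by simp
    qed
    show "\<exists>r\<^sub>0>0. \<exists>\<beta>\<^sub>0>0. \<beta>\<^sub>0 * r\<^sub>0\<^sup>2 = c\<^sub>0 \<and>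
      (\<forall>(\<Omega> :: (real ^ 'n) set) \<phi> D x.
       asymmetric_domain \<alpha> \<Omega> \<and> ground_state \<Omega> \<phi> \<and>
       domain_set D \<and> bounded D \<and> max_dist \<Omega> \<phi> D x > 0 \<longrightarrow>
       (let l = first_dirichlet_eigenvalue \<Omega>;
            \<beta> = beta_fun c\<^sub>0 r\<^sub>0 \<beta>\<^sub>0 l
        in continuous_on {0<..} \<beta> \<and> antimono_on {0<..} \<beta> \<and> (\<forall>\<rho>>0. \<beta> \<rho> > 0) \<and>
           rayleigh_lambda1 (\<Omega> - translate x D) \<le> ereal (\<beta> (max_dist \<Omega> \<phi> D x) * l)))"
      unfolding Let_def using r0 b0 main by blast
  qed
qed

end
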